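(* Let $a,b,c,u,v$ be non-negative integers with $u$, $v$ and $c$ positive, and let $g = x^a y^b (x^u + y^v)^c \in \mathbb{Z}[x,y]$, whose reduction modulo each prime $p$ is also denoted $g$. Set $$\lambda_0 = \frac{\frac1u+\frac1v}{\frac au+\frac bv+c},\qquad \lambda=\min\left\{\tfrac1a,\tfrac1b,\tfrac1c,\lambda_0\right\}.$$ Let $$\psi(t) = \lim_{p\to\infty} s(\mathbb{F}_p\llbracket x,y\rrbracket, g^t),$$ the limit being over primes $p$. Then for every real $t$ with $0\le t<\lambda$ the limit exists and is given by: 1. If $tav+u \ge tbu+v+cuvt$, then $\psi(t)=(1-at)(1-(b+cv)t)$. 2. If $tbu+v\ge tav+u+cuvt$, then $\psi(t)=(1-bt)(1-(a+cu)t)$. 3. If $tcuv+u+v\ge tav+tbu+2uv$, then $\psi(t)=(1-ct)\,(v(1-at)+u(1-bt)-uv)$. 4. Otherwise, $\psi(t)=\frac{1}{4uv}\,(u+v-t(av+bu+cuv))^2$.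
   Context: For a prime $p$, $R=\mathbb{F}_p\llbracket x,y\rrbracket$, a nonzero $g\in(x,y)$ and real $t\ge 0$, the $F$-signature of the pair $(R,g^t)$ is $$s(R,g^t)=\lim_{e\to\infty}\frac{1}{p^{2e}}\,\ell\!\left(\frac{R}{(x^{p^e},y^{p^e}):g^{\lceil tp^e\rceil}}\right),$$ where $\ell$ denotes length as an $R$-module (this limit exists). Convention: $1/0=+\infty$. *)

theory Defs
  imports
    "HOL-Computational_Algebra.Polynomial"
    "HOL-Number_Theory.Residues"
    "HOL-Algebra.QuotRing"
    "HOL-Algebra.Module"
    "HOL-Library.Extended_Nat"
    "HOL-Library.Extended_Real"
begin

text \<open>
  The ring \<open>R\<lbrakk>x, y\<rbrakk>\<close>: a series is its coefficient function, \<open>f i j\<close> being the coefficient of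
  \<open>x\<^sup>i y\<^sup>j\<close>. A carrier-based ring is used because the prime varies inside the statement.
\<close>

definition fps2 :: "('a, 'm) ring_scheme \<Rightarrow> (nat \<Rightarrow> nat \<Rightarrow> 'a) ring" where
  "fps2 R =
    \<lparr>carrier = {f. \<forall>i j. f i j \<in> carrier R},
     monoid.mult = (\<lambda>f g i j. \<Oplus>\<^bsub>R\<^esub>k\<in>{..i}. \<Oplus>\<^bsub>R\<^esub>l\<in>{..j}. f k l \<otimes>\<^bsub>R\<^esub> g (i - k) (j - l)),
     one = (\<lambda>i j. if i = 0 \<and> j = 0 then \<one>\<^bsub>R\<^esub> else \<zero>\<^bsub>R\<^esub>),
     ring.zero = (\<lambda>i j. \<zero>\<^bsub>R\<^esub>),
     ring.add = (\<lambda>f g i j. f i j \<oplus>\<^bsub>R\<^esub> g i j)\<rparr>"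

definition fps2_X :: "('a, 'm) ring_scheme \<Rightarrow> nat \<Rightarrow> nat \<Rightarrow> 'a" where
  "fps2_X R = (\<lambda>i j. if i = 1 \<and> j = 0 then \<one>\<^bsub>R\<^esub> else \<zero>\<^bsub>R\<^esub>)"

definition fps2_Y :: "('a, 'm) ring_scheme \<Rightarrow> nat \<Rightarrow> nat \<Rightarrow> 'a" where
  "fps2_Y R = (\<lambda>i j. if i = 0 \<and> j = 1 then \<one>\<^bsub>R\<^esub> else \<zero>\<^bsub>R\<^esub>)"

definition colon_ideal :: "('a, 'm) ring_scheme \<Rightarrow> 'a set \<Rightarrow> 'a \<Rightarrow> 'a set" where
  "colon_ideal R I g = {r \<in> carrier R. r \<otimes>\<^bsub>R\<^esub> g \<in> I}"

definition quotient_module :: "('a, 'm) ring_scheme \<Rightarrow> 'a set \<Rightarrow> ('a, 'a set) module" where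
  "quotient_module R I =
    \<lparr>carrier = carrier (R Quot I), monoid.mult = monoid.mult (R Quot I), one = monoid.one (R Quot I),
     ring.zero = ring.zero (R Quot I), ring.add = ring.add (R Quot I),
     module.smult = (\<lambda>r A. (I +>\<^bsub>R\<^esub> r) \<otimes>\<^bsub>R Quot I\<^esub> A)\<rparr>"

text \<open>Length of a module: the supremum of the lengths \<open>n\<close> of strict chains
  \<open>N 0 \<subset> \<dots> \<subset> N n\<close> of submodules.\<close>

definition module_length :: "('a, 'm) ring_scheme \<Rightarrow> ('a, 'b, 'n) module_scheme \<Rightarrow> enat" where
  "module_length R M =
    Sup {enat n | n. \<exists>N. (\<forall>i\<le>n. submodule (N i) R M) \<and> (\<forall>i<n. N i \<subset> N (Suc i))}"

abbreviation Fp_xy :: "nat \<Rightarrow> (nat \<Rightarrow> nat \<Rightarrow> int) ring" where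
  "Fp_xy p \<equiv> fps2 (residue_ring (int p))"

definition frobenius_ideal :: "nat \<Rightarrow> nat \<Rightarrow> (nat \<Rightarrow> nat \<Rightarrow> int) set" where
  "frobenius_ideal p e =
    Idl\<^bsub>Fp_xy p\<^esub> {fps2_X (residue_ring (int p)) [^]\<^bsub>Fp_xy p\<^esub> (p ^ e),
                fps2_Y (residue_ring (int p)) [^]\<^bsub>Fp_xy p\<^esub> (p ^ e)}"

text \<open>All the lengths below are finite for prime \<open>p\<close>, so \<^const>\<open>the_enat\<close> only changes the type.\<close>

definition F_signature :: "nat \<Rightarrow> (nat \<Rightarrow> nat \<Rightarrow> int) \<Rightarrow> real \<Rightarrow> real" where
  "F_signature p g t =
    lim (\<lambda>e::nat.
      real (the_enat (module_length (Fp_xy p)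
        (quotient_module (Fp_xy p)
          (colon_ideal (Fp_xy p) (frobenius_ideal p e)
            (g [^]\<^bsub>Fp_xy p\<^esub> nat \<lceil>t * real p ^ e\<rceil>)))))
      / real p ^ (2 * e))"

text \<open>\<open>\<int>[x, y]\<close> is \<^typ>\<open>int poly poly\<close>, with \<open>y\<close> the outer variable.\<close>

definition poly_g :: "nat \<Rightarrow> nat \<Rightarrow> nat \<Rightarrow> nat \<Rightarrow> nat \<Rightarrow> int poly poly" where
  "poly_g a b c u v =
    (let x = [:[:0, 1:]:]; y = [:0, 1:] in x ^ a * y ^ b * (x ^ u + y ^ v) ^ c)"

definition reduce_mod :: "nat \<Rightarrow> int poly poly \<Rightarrow> nat \<Rightarrow> nat \<Rightarrow> int" where
  "reduce_mod p G = (\<lambda>i j. Polynomial.coeff (Polynomial.coeff G j) i mod int p)"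

definition lambda0 :: "nat \<Rightarrow> nat \<Rightarrow> nat \<Rightarrow> nat \<Rightarrow> nat \<Rightarrow> real" where
  "lambda0 a b c u v = (1 / real u + 1 / real v) / (real a / real u + real b / real v + real c)"

text \<open>Taken in \<^typ>\<open>ereal\<close>, where \<open>1 / 0 = \<infinity>\<close>.\<close>

definition lambda :: "nat \<Rightarrow> nat \<Rightarrow> nat \<Rightarrow> nat \<Rightarrow> nat \<Rightarrow> ereal" where
  "lambda a b c u v =
    Min {1 / ereal (real a), 1 / ereal (real b), 1 / ereal (real c), ereal (lambda0 a b c u v)}"

text \<open>The filter of \<open>p \<rightarrow> \<infinity>\<close> through the primes.\<close>

definition at_top_primes :: "nat filter" where
  "at_top_primes = inf at_top (principal {p. Factorial_Ring.prime p})"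

end

theory Submission
  imports Defs "HOL-Library.Disjoint_Sets" "HOL-Computational_Algebra.Formal_Power_Series"
begin

text \<open>
  As the residue field is \<open>\<int>/p\<close>, a finite module has length \<open>log\<^sub>p\<close> of its cardinality, so the
  length of \<open>R/((x\<^sup>q, y\<^sup>q) : g\<^sup>N)\<close> is \<open>log\<^sub>p\<close> of the number of multiples of \<open>g\<^sup>N\<close> modulo \<open>(x\<^sup>q, y\<^sup>q)\<close>.
  It decreases with \<open>N\<close>, and Frobenius multiplies it by \<open>p\<^sup>2\<close> when \<open>(q, N)\<close> is replaced by
  \<open>(pq, pN)\<close>. Hence the sequence defining \<open>s(g\<^sup>t)\<close> is increasing in \<open>e\<close>, and \<open>s(g\<^sup>t)\<close> lies between the
  terms for \<open>q = p\<close> with \<open>N = \<lceil>tp\<rceil>\<close> and \<open>N = \<lfloor>tp\<rfloor>\<close>.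

  For \<open>q = p\<close>, multiplication by \<open>g\<^sup>N\<close> is a direct sum of multiplications by \<open>(x + y)\<^sup>M\<close>, \<open>M = cN\<close>, on the
  forms of degree \<open>d\<close> in rings \<open>\<int>/p[x, y]/(x\<^sup>m, y\<^sup>n)\<close> with \<open>m \<approx> (p - aN)/u\<close> and \<open>n \<approx> (p - bN)/v\<close>. For
  \<open>m, n, M \<le> p\<close> the rank of such a map is the smallest of \<open>d + 1\<close>, \<open>m\<close>, \<open>n\<close>, \<open>p - M\<close> and
  \<open>m + n - M - 1 - d\<close>. The bound \<open>p - M\<close> comes from \<open>(x + y)\<^sup>p = x\<^sup>p + y\<^sup>p\<close>; injectivity is proved by
  induction on \<open>d\<close>, using the derivation \<open>\<partial>/\<partial>x - \<partial>/\<partial>y\<close>, which kills \<open>x + y\<close>. The sum over \<open>d\<close> is the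
  area of a (possibly degenerate) trapezoid, whose shape yields the four cases.
\<close>

section \<open>Images of integer matrices modulo \<open>p\<close>\<close>

text \<open>Staying with q = p keeps the ranks elementary: the rank of a power of x + y modulo (x^m,
  y^n) in general depends on base p expansions, while below p the binomial coefficients that matter
  are units. The error of the term for q = p disappears only because p tends to infinity. After
  division by p, the sizes m, n, M tend to \<alpha> = (1 - at)/u, \<beta> = (1 - bt)/v, \<gamma> =
  ct. The trapezoid has base \<alpha> + \<beta> - \<gamma>, sides of slope 1 and -1, and is cut at
  height min(\<alpha>, \<beta>, 1 - \<gamma>). The conditions at, bt, ct < 1 make this height
  positive, and t < \<open>lambda0\<close> says that the base is positive. Cases 1, 2, 3 say that
  twice \<alpha>, \<beta>, 1 - \<gamma>, respectively, is at most the base, so that the cut happens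
  at that height; in case 4 the cut misses and a full triangle remains.\<close>

definition mod_map :: "nat \<Rightarrow> 'a set \<Rightarrow> 'b set \<Rightarrow> ('a \<Rightarrow> 'b \<Rightarrow> int) \<Rightarrow> ('a \<Rightarrow> int) \<Rightarrow> 'b \<Rightarrow> int" where
  "mod_map p S T w h \<tau> = (if \<tau> \<in> T then (\<Sum>\<sigma>\<in>S. h \<sigma> * w \<sigma> \<tau>) mod int p else 0)"

text \<open>The image is a subspace of (Z/p)^T, stored by representatives in {0..<p} and extended by
  0 outside T, so its cardinality is p to the rank. Cardinalities stand for ranks throughout; they
  are also what the length of a finite module is read off from.\<close>

definition mod_image :: "nat \<Rightarrow> 'a set \<Rightarrow> 'b set \<Rightarrow> ('a \<Rightarrow> 'b \<Rightarrow> int) \<Rightarrow> ('b \<Rightarrow> int) set" where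
  "mod_image p S T w = range (mod_map p S T w)"

lemma finite_bounded_functions:
  assumes "finite T"
  shows "finite {f :: 'b \<Rightarrow> int. (\<forall>x\<in>T. f x \<in> {0..<int p}) \<and> (\<forall>x. x \<notin> T \<longrightarrow> f x = 0)}"
    and "card {f :: 'b \<Rightarrow> int. (\<forall>x\<in>T. f x \<in> {0..<int p}) \<and> (\<forall>x. x \<notin> T \<longrightarrow> f x = 0)} = p ^ card T"
proof -
  let ?F = "{f :: 'b \<Rightarrow> int. (\<forall>x\<in>T. f x \<in> {0..<int p}) \<and> (\<forall>x. x \<notin> T \<longrightarrow> f x = 0)}"
  have "bij_betw (\<lambda>f. restrict f T) ?F (T \<rightarrow>\<^sub>E {0..<int p})"
  proof (rule bij_betw_byWitness[where f' = "\<lambda>f x. if x \<in> T then f x else 0"])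
    show "\<forall>f\<in>?F. (\<lambda>x. if x \<in> T then restrict f T x else 0) = f"
      by auto
    show "\<forall>f\<in>T \<rightarrow>\<^sub>E {0..<int p}. restrict (\<lambda>x. if x \<in> T then f x else 0) T = f"
      by (auto simp: fun_eq_iff PiE_def extensional_def)
  qed (auto simp: PiE_iff)
  then show "finite ?F" "card ?F = p ^ card T"
    using assms by (auto simp: bij_betw_finite bij_betw_same_card card_PiE finite_PiE)
qed

lemma mod_image_subset:
  assumes "p > 0"
  shows "mod_image p S T w \<subseteq> {f. (\<forall>x\<in>T. f x \<in> {0..<int p}) \<and> (\<forall>x. x \<notin> T \<longrightarrow> f x = 0)}"
  using assms by (auto simp: mod_image_def mod_map_def)

lemma finite_mod_image: "p > 0 \<Longrightarrow> finite T \<Longrightarrow> finite (mod_image p S T w)"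
  by (rule finite_subset[OF mod_image_subset finite_bounded_functions(1)])

lemma card_mod_image_le_target:
  assumes "p > 0" "finite T"
  shows "card (mod_image p S T w) \<le> p ^ card T"
  using card_mono[OF finite_bounded_functions(1)[OF assms(2)] mod_image_subset[OF assms(1)]]
  by (simp only: finite_bounded_functions(2)[OF assms(2)])

lemma mod_image_mod_cong:
  assumes "\<And>\<sigma> \<tau>. \<sigma> \<in> S \<Longrightarrow> \<tau> \<in> T \<Longrightarrow> [w \<sigma> \<tau> = w' \<sigma> \<tau>] (mod int p)"
  shows "mod_image p S T w = mod_image p S T w'"
proof -
  have "(\<Sum>\<sigma>\<in>S. h \<sigma> * w \<sigma> \<tau>) mod int p = (\<Sum>\<sigma>\<in>S. h \<sigma> * w' \<sigma> \<tau>) mod int p" if "\<tau> \<in> T" for h \<tau>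
    using cong_sum[of S "\<lambda>\<sigma>. h \<sigma> * w \<sigma> \<tau>" "\<lambda>\<sigma>. h \<sigma> * w' \<sigma> \<tau>" "int p"] assms that
    by (simp add: cong_scalar_left cong_def[symmetric])
  then have "mod_map p S T w = mod_map p S T w'"
    by (auto simp: fun_eq_iff mod_map_def)
  then show ?thesis
    unfolding mod_image_def by (rule arg_cong)
qed

lemma mod_image_mono_source:
  assumes "finite S" "S' \<subseteq> S"
  shows "mod_image p S' T w \<subseteq> mod_image p S T w"
proof
  fix f assume "f \<in> mod_image p S' T w"
  then obtain h where h: "f = mod_map p S' T w h"
    by (auto simp: mod_image_def)
  have "(\<Sum>\<sigma>\<in>S'. h \<sigma> * w \<sigma> \<tau>) = (\<Sum>\<sigma>\<in>S. (if \<sigma> \<in> S' then h \<sigma> else 0) * w \<sigma> \<tau>)" for \<tau>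
    using assms by (auto intro!: sum.mono_neutral_cong_left)
  then have "f = mod_map p S T w (\<lambda>\<sigma>. if \<sigma> \<in> S' then h \<sigma> else 0)"
    unfolding h by (auto simp: fun_eq_iff mod_map_def)
  then show "f \<in> mod_image p S T w"
    by (simp add: mod_image_def)
qed

text \<open>Only the residues of h on S matter, so the functions from S to {0..<p} already produce
  the whole image.\<close>

lemma card_mod_image_le_source:
  assumes "p > 0" "finite S" "finite T"
  shows "card (mod_image p S T w) \<le> p ^ card S"
proof -
  let ?F = "{f. (\<forall>x\<in>S. f x \<in> {0..<int p}) \<and> (\<forall>x. x \<notin> S \<longrightarrow> f x = 0)}"
  let ?L = "mod_map p S T w"
  have "mod_image p S T w \<subseteq> ?L ` ?F"
  proof
    fix f assume "f \<in> mod_image p S T w"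
    then obtain h where h: "f = ?L h"
      by (auto simp: mod_image_def)
    let ?h = "\<lambda>\<sigma>. if \<sigma> \<in> S then h \<sigma> mod int p else 0"
    have "(\<Sum>\<sigma>\<in>S. h \<sigma> * w \<sigma> \<tau>) mod int p = (\<Sum>\<sigma>\<in>S. ?h \<sigma> * w \<sigma> \<tau>) mod int p" for \<tau>
      unfolding cong_def[symmetric] by (rule cong_sum) (auto simp: cong_def mod_simps)
    then have "f = ?L ?h"
      unfolding h by (auto simp: fun_eq_iff mod_map_def)
    moreover have "?h \<in> ?F"
      using assms by auto
    ultimately show "f \<in> ?L ` ?F"
      by (rule image_eqI)
  qed
  then have "card (mod_image p S T w) \<le> card ?F"
    using finite_bounded_functions(1)[OF assms(2)] by (meson card_image_le card_mono finite_imageI le_trans)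
  then show ?thesis
    using finite_bounded_functions(2)[OF assms(2)] by metis
qed

text \<open>A kernel that is trivial modulo p makes the map injective on reduced vectors: apply
  \<open>inj\<close> to the difference of two of them.\<close>

lemma card_mod_image_ge_source:
  assumes "p > 0" "finite S" "finite T"
    and inj: "\<And>h \<sigma>. (\<And>\<tau>. \<tau> \<in> T \<Longrightarrow> int p dvd (\<Sum>\<sigma>\<in>S. h \<sigma> * w \<sigma> \<tau>)) \<Longrightarrow> \<sigma> \<in> S \<Longrightarrow> int p dvd h \<sigma>"
  shows "p ^ card S \<le> card (mod_image p S T w)"
proof -
  let ?F = "{f. (\<forall>x\<in>S. f x \<in> {0..<int p}) \<and> (\<forall>x. x \<notin> S \<longrightarrow> f x = 0)}"
  let ?L = "mod_map p S T w"
  have "inj_on ?L ?F"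
  proof (rule inj_onI)
    fix f g assume fg: "f \<in> ?F" "g \<in> ?F" "?L f = ?L g"
    have "int p dvd f \<sigma> - g \<sigma>" if "\<sigma> \<in> S" for \<sigma>
    proof (rule inj[OF _ that])
      fix \<tau> assume "\<tau> \<in> T"
      then have "(\<Sum>\<sigma>\<in>S. f \<sigma> * w \<sigma> \<tau>) mod int p = (\<Sum>\<sigma>\<in>S. g \<sigma> * w \<sigma> \<tau>) mod int p"
        using fun_cong[OF fg(3), of \<tau>] by (simp add: mod_map_def)
      then show "int p dvd (\<Sum>\<sigma>\<in>S. (f \<sigma> - g \<sigma>) * w \<sigma> \<tau>)"
        by (simp add: mod_eq_dvd_iff left_diff_distrib sum_subtractf)
    qed
    then have "f \<sigma> mod int p = g \<sigma> mod int p" if "\<sigma> \<in> S" for \<sigma>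
      using that by (simp add: mod_eq_dvd_iff)
    then have "f \<sigma> = g \<sigma>" if "\<sigma> \<in> S" for \<sigma>
      using fg(1,2) that by simp
    moreover have "f \<sigma> = g \<sigma>" if "\<sigma> \<notin> S" for \<sigma>
      using fg(1,2) that by simp
    ultimately show "f = g"
      by blast
  qed
  then have "card ?F = card (?L ` ?F)"
    by (simp add: card_image)
  also have "\<dots> \<le> card (mod_image p S T w)"
    using finite_mod_image[OF assms(1,3)] by (intro card_mono) (auto simp: mod_image_def)
  finally show ?thesis
    using finite_bounded_functions(2)[OF assms(2)] by metis
qed

lemma card_mod_image_reindex:
  assumes "inj_on f S" "inj_on g T"
  shows "card (mod_image p (f ` S) (g ` T) w) = card (mod_image p S T (\<lambda>\<sigma> \<tau>. w (f \<sigma>) (g \<tau>)))"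
proof (rule bij_betw_same_card[of "\<lambda>F \<tau>. if \<tau> \<in> T then F (g \<tau>) else 0"], rule bij_betw_imageI)
  let ?r = "\<lambda>F \<tau>. if \<tau> \<in> T then F (g \<tau>) else 0"
  show "inj_on ?r (mod_image p (f ` S) (g ` T) w)"
  proof (rule inj_onI)
    fix F G assume F: "F \<in> mod_image p (f ` S) (g ` T) w" "G \<in> mod_image p (f ` S) (g ` T) w" "?r F = ?r G"
    have "F (g \<tau>) = G (g \<tau>)" if "\<tau> \<in> T" for \<tau>
      using fun_cong[OF F(3), of \<tau>] that by simp
    moreover have "F x = G x" if "x \<notin> g ` T" for x
      using F(1,2) that by (auto simp: mod_image_def mod_map_def)
    ultimately show "F = G"
      by (metis (no_types, lifting) ext image_iff)
  qed
  have *: "(\<Sum>\<sigma>\<in>f ` S. h \<sigma> * w \<sigma> \<tau>) = (\<Sum>\<sigma>\<in>S. h (f \<sigma>) * w (f \<sigma>) \<tau>)" for h \<tau>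
    by (simp add: sum.reindex[OF assms(1)])
  show "?r ` mod_image p (f ` S) (g ` T) w = mod_image p S T (\<lambda>\<sigma> \<tau>. w (f \<sigma>) (g \<tau>))"
  proof (intro equalityI subsetI)
    fix F assume "F \<in> ?r ` mod_image p (f ` S) (g ` T) w"
    then obtain h where h: "F = ?r (mod_map p (f ` S) (g ` T) w h)"
      unfolding mod_image_def by blast
    then have "F = mod_map p S T (\<lambda>\<sigma> \<tau>. w (f \<sigma>) (g \<tau>)) (\<lambda>\<sigma>. h (f \<sigma>))"
      by (auto simp: fun_eq_iff * mod_map_def)
    then show "F \<in> mod_image p S T (\<lambda>\<sigma> \<tau>. w (f \<sigma>) (g \<tau>))"
      by (simp add: mod_image_def)
  next
    fix F assume "F \<in> mod_image p S T (\<lambda>\<sigma> \<tau>. w (f \<sigma>) (g \<tau>))"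
    then obtain h where h: "F = mod_map p S T (\<lambda>\<sigma> \<tau>. w (f \<sigma>) (g \<tau>)) h"
      unfolding mod_image_def by blast
    define h' where "h' = (\<lambda>\<sigma>. h (inv_into S f \<sigma>))"
    have "(\<Sum>\<sigma>\<in>S. h \<sigma> * w (f \<sigma>) \<tau>) = (\<Sum>\<sigma>\<in>S. h' (f \<sigma>) * w (f \<sigma>) \<tau>)" for \<tau>
      using assms(1) by (intro sum.cong) (simp_all add: h'_def)
    then have "F = ?r (mod_map p (f ` S) (g ` T) w h')"
      using h by (simp add: * fun_eq_iff mod_map_def)
    then show "F \<in> ?r ` mod_image p (f ` S) (g ` T) w"
      by (rule image_eqI[of F ?r "mod_map p (f ` S) (g ` T) w h'"]) (simp add: mod_image_def)
  qed
qed

text \<open>Targets outside all \<open>T\<^sub>\<iota>\<close> are never hit.\<close>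

lemma card_mod_image_blocks:
  assumes "finite I" "finite S" "\<And>\<iota>. \<iota> \<in> I \<Longrightarrow> Tb \<iota> \<subseteq> T"
    and S: "S = (\<Union>\<iota>\<in>I. Sb \<iota>)" and "disjoint_family_on Sb I" "disjoint_family_on Tb I"
    and w: "\<And>\<iota> \<sigma> \<tau>. \<iota> \<in> I \<Longrightarrow> \<sigma> \<in> Sb \<iota> \<Longrightarrow> \<tau> \<in> T \<Longrightarrow> \<tau> \<notin> Tb \<iota> \<Longrightarrow> int p dvd w \<sigma> \<tau>"
  shows "card (mod_image p S T w) = (\<Prod>\<iota>\<in>I. card (mod_image p (Sb \<iota>) (Tb \<iota>) w))"
proof -
  let ?r = "\<lambda>F. \<lambda>\<iota>\<in>I. \<lambda>\<tau>. if \<tau> \<in> Tb \<iota> then F \<tau> else 0"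
  let ?L = "\<lambda>S T. mod_map p S T w"
  have fin: "finite (Sb \<iota>)" if "\<iota> \<in> I" for \<iota>
    using that assms(2) S by (auto intro: finite_subset)
  have split: "(\<Sum>\<sigma>\<in>S. h \<sigma> * w \<sigma> \<tau>) = (\<Sum>\<iota>\<in>I. \<Sum>\<sigma>\<in>Sb \<iota>. h \<sigma> * w \<sigma> \<tau>)" for h \<tau>
    unfolding S using assms(1,5) fin
    by (intro sum.UNION_disjoint) (auto simp: disjoint_family_on_def)
  have other: "int p dvd (\<Sum>\<sigma>\<in>Sb \<iota>. h \<sigma> * w \<sigma> \<tau>)" if "\<iota> \<in> I" "\<tau> \<in> T" "\<tau> \<notin> Tb \<iota>" for \<iota> \<tau> h
    using w[OF that(1) _ that(2,3)] by (intro dvd_sum dvd_mult) auto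
  have block: "(\<Sum>\<sigma>\<in>S. h \<sigma> * w \<sigma> \<tau>) mod int p = (\<Sum>\<sigma>\<in>Sb \<iota>. h \<sigma> * w \<sigma> \<tau>) mod int p"
    if "\<iota> \<in> I" "\<tau> \<in> Tb \<iota>" for \<iota> \<tau> h
  proof -
    have "int p dvd (\<Sum>\<iota>'\<in>I - {\<iota>}. \<Sum>\<sigma>\<in>Sb \<iota>'. h \<sigma> * w \<sigma> \<tau>)"
    proof (intro dvd_sum[where A = "I - {\<iota>}"] other)
      fix \<iota>' assume "\<iota>' \<in> I - {\<iota>}"
      then show "\<tau> \<notin> Tb \<iota>'"
        using that assms(6) by (auto simp: disjoint_family_on_def)
    qed (use that assms(3) in auto)
    then show ?thesis
      unfolding split using sum.remove[OF assms(1) that(1), of "\<lambda>\<iota>. \<Sum>\<sigma>\<in>Sb \<iota>. h \<sigma> * w \<sigma> \<tau>"]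
      by (simp add: mod_eq_dvd_iff)
  qed
  have out: "int p dvd (\<Sum>\<sigma>\<in>S. h \<sigma> * w \<sigma> \<tau>)"
    if "\<tau> \<in> T" "\<And>\<iota>. \<iota> \<in> I \<Longrightarrow> \<tau> \<notin> Tb \<iota>" for \<tau> h
    using that unfolding split by (intro dvd_sum[where A = I] other) auto
  \<comment> \<open>A block diagonal matrix has the product of the block images as its image.
    Restriction to the blocks loses nothing, since by \<open>out\<close> all values elsewhere in T
    are 0.\<close>
  have "bij_betw ?r (mod_image p S T w) (PiE I (\<lambda>\<iota>. mod_image p (Sb \<iota>) (Tb \<iota>) w))"
  proof (rule bij_betw_imageI)
    show "inj_on ?r (mod_image p S T w)"
    proof (rule inj_onI)
      fix F G assume F: "F \<in> mod_image p S T w" "G \<in> mod_image p S T w" "?r F = ?r G"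
      show "F = G"
      proof
        fix \<tau>
        consider "\<tau> \<notin> T" | \<iota> where "\<iota> \<in> I" "\<tau> \<in> Tb \<iota>" | "\<tau> \<in> T" "\<And>\<iota>. \<iota> \<in> I \<Longrightarrow> \<tau> \<notin> Tb \<iota>"
          by blast
        then show "F \<tau> = G \<tau>"
        proof cases
          case 2
          then show ?thesis
            using fun_cong[OF fun_cong[OF F(3), of \<iota>], of \<tau>] by simp
        qed (use F(1,2) out in \<open>auto simp: mod_image_def mod_map_def\<close>)
      qed
    qed
    show "?r ` mod_image p S T w = PiE I (\<lambda>\<iota>. mod_image p (Sb \<iota>) (Tb \<iota>) w)"
    proof (intro equalityI subsetI)
      fix P assume "P \<in> ?r ` mod_image p S T w"
      then obtain h where h: "P = ?r (?L S T h)"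
        unfolding mod_image_def by blast
      have "P = (\<lambda>\<iota>\<in>I. ?L (Sb \<iota>) (Tb \<iota>) h)"
        unfolding h
        by (intro restrict_ext ext) (use block assms(3) in \<open>auto simp: mod_map_def subset_iff\<close>)
      then show "P \<in> PiE I (\<lambda>\<iota>. mod_image p (Sb \<iota>) (Tb \<iota>) w)"
        by (auto simp: mod_image_def)
    next
      fix P assume P: "P \<in> PiE I (\<lambda>\<iota>. mod_image p (Sb \<iota>) (Tb \<iota>) w)"
      have "\<forall>\<iota>\<in>I. \<exists>h. P \<iota> = ?L (Sb \<iota>) (Tb \<iota>) h"
        using P by (auto simp: mod_image_def PiE_iff)
      then obtain H where H: "\<And>\<iota>. \<iota> \<in> I \<Longrightarrow> P \<iota> = ?L (Sb \<iota>) (Tb \<iota>) (H \<iota>)"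
        by metis
      \<comment> \<open>The source blocks are disjoint, so preimages chosen block by block glue to
        one h.\<close>
      define h where "h = (\<lambda>\<sigma>. H (THE \<iota>. \<iota> \<in> I \<and> \<sigma> \<in> Sb \<iota>) \<sigma>)"
      have hH: "h \<sigma> = H \<iota> \<sigma>" if "\<iota> \<in> I" "\<sigma> \<in> Sb \<iota>" for \<sigma> \<iota>
      proof -
        have "(THE \<iota>. \<iota> \<in> I \<and> \<sigma> \<in> Sb \<iota>) = \<iota>"
          using that assms(5) by (intro the_equality) (auto simp: disjoint_family_on_def)
        then show ?thesis by (simp add: h_def)
      qed
      have "P = ?r (?L S T h)"
      proof
        fix \<iota> show "P \<iota> = ?r (?L S T h) \<iota>"
        proof (cases "\<iota> \<in> I")
          case True
          have "(\<Sum>\<sigma>\<in>Sb \<iota>. h \<sigma> * w \<sigma> \<tau>) = (\<Sum>\<sigma>\<in>Sb \<iota>. H \<iota> \<sigma> * w \<sigma> \<tau>)" for \<tau>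
            using hH[OF True] by (intro sum.cong) auto
          then show ?thesis
            using True H[OF True] block[OF True] assms(3)[OF True] by (auto simp: fun_eq_iff mod_map_def)
        next
          case False
          then show ?thesis using P by auto
        qed
      qed
      then show "P \<in> ?r ` mod_image p S T w"
        by (rule image_eqI[of P ?r "?L S T h"]) (simp add: mod_image_def)
    qed
  qed
  then have "card (mod_image p S T w) = card (PiE I (\<lambda>\<iota>. mod_image p (Sb \<iota>) (Tb \<iota>) w))"
    by (rule bij_betw_same_card)
  then show ?thesis
    by (simp only: card_PiE[OF assms(1)])
qed

section \<open>Multiplication by a power of \<open>x + y\<close>\<close>

text \<open>The coefficient of x^i y^(d + M - i) in x^k y^(d - k) (x + y)^M, which does not depend
  on d. The test k \<le> i is needed because i - k is truncated and M choose 0 is 1.\<close>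

definition tcoeff :: "nat \<Rightarrow> nat \<Rightarrow> nat \<Rightarrow> int" where
  "tcoeff M k i = (if k \<le> i then int (M choose (i - k)) else 0)"

lemma not_dvd_choose:
  assumes "prime p" "s < p" "i \<le> s"
  shows "\<not> p dvd (s choose i)"
proof
  assume "p dvd (s choose i)"
  then have "p dvd fact i * fact (s - i) * (s choose i)"
    by simp
  then have "p dvd fact s"
    using binomial_fact_lemma[OF assms(3)] by simp
  then show False
    using assms by (simp add: prime_dvd_fact_iff)
qed

text \<open>This is (x + y)^d (x + y)^M = (x + y)^(d + M), read off at the exponent i.\<close>

lemma sum_choose_tcoeff: "(\<Sum>k\<le>d. int (d choose k) * tcoeff M k i) = int ((d + M) choose i)"
proof -
  have "(\<Sum>k\<le>d. int (d choose k) * tcoeff M k i) = (\<Sum>k\<le>max d i. int (d choose k) * tcoeff M k i)"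
    by (rule sum.mono_neutral_left) (auto simp: max_def binomial_eq_0)
  also have "\<dots> = (\<Sum>k\<le>i. int (d choose k) * tcoeff M k i)"
    by (rule sum.mono_neutral_right) (auto simp: tcoeff_def)
  also have "\<dots> = (\<Sum>k\<le>i. int ((d choose k) * (M choose (i - k))))"
    by (rule sum.cong) (auto simp: tcoeff_def)
  also have "\<dots> = int ((d + M) choose i)"
    by (simp only: vandermonde of_nat_sum[symmetric] add.commute)
  finally show ?thesis .
qed

lemma tcoeff_Suc_Suc: "tcoeff M (Suc k) (Suc i) = tcoeff M k i"
  by (simp add: tcoeff_def)

text \<open>With j = i - k this is (j + 1) binom(M, j + 1) = (M - j) binom(M, j). The factors are
  integers, not truncated differences, so that the identity survives at k = i + 1, where the left
  factor is 0.\<close>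

lemma tcoeff_deriv:
  "(int i + 1 - int k) * tcoeff M k (Suc i) = (int M - int i + int k) * tcoeff M k i"
proof (cases "k \<le> i")
  case True
  define j where "j = i - k"
  have i: "i = k + j" using True by (simp add: j_def)
  have "Suc j * (M choose Suc j) = (M - j) * (M choose j)"
    by (metis binomial_absorb_comp binomial_absorption mult.commute)
  moreover have "int ((M - j) * (M choose j)) = (int M - int j) * int (M choose j)"
    by (cases "j \<le> M") (simp_all add: of_nat_diff binomial_eq_0)
  ultimately have "int (Suc j) * int (M choose Suc j) = (int M - int j) * int (M choose j)"
    by (metis of_nat_mult)
  then show ?thesis
    by (simp add: tcoeff_def i algebra_simps)
next
  case False
  then show ?thesis by (cases "k = Suc i") (auto simp: tcoeff_def)
qed

text \<open>Coefficients of the derivation \<open>\<partial>/\<partial>x - \<partial>/\<partial>y\<close> applied to a form of degree \<open>d + 1\<close>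
  times \<open>(x + y)\<^sup>M\<close>; the derivation kills \<open>x + y\<close>.\<close>

lemma sum_tcoeff_deriv:
  "(\<Sum>k\<le>d. (int (Suc k) * h (Suc k) - int (Suc d - k) * h k) * tcoeff M k i)
    = (int i + 1) * (\<Sum>k\<le>Suc d. h k * tcoeff M k (Suc i))
      - (int d + 1 + int M - int i) * (\<Sum>k\<le>Suc d. h k * tcoeff M k i)"
proof -
  have 1: "(\<Sum>k\<le>d. int (Suc k) * h (Suc k) * tcoeff M k i) = (\<Sum>k\<le>Suc d. int k * h k * tcoeff M k (Suc i))"
    by (simp only: sum.atMost_Suc_shift) (simp add: tcoeff_Suc_Suc)
  have 2: "(\<Sum>k\<le>d. int (Suc d - k) * h k * tcoeff M k i) = (\<Sum>k\<le>Suc d. (int d + 1 - int k) * h k * tcoeff M k i)"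
    by (simp add: of_nat_diff add.commute)
  have "(\<Sum>k\<le>d. (int (Suc k) * h (Suc k) - int (Suc d - k) * h k) * tcoeff M k i)
    = (\<Sum>k\<le>Suc d. int k * h k * tcoeff M k (Suc i)) - (\<Sum>k\<le>Suc d. (int d + 1 - int k) * h k * tcoeff M k i)"
    by (simp only: left_diff_distrib sum_subtractf 1 2)
  also have "\<dots> = (\<Sum>k\<le>Suc d. (int i + 1) * (h k * tcoeff M k (Suc i))
      - (int d + 1 + int M - int i) * (h k * tcoeff M k i))"
    unfolding sum_subtractf[symmetric]
  proof (rule sum.cong[OF refl])
    fix k
    have "h k * ((int i + 1 - int k) * tcoeff M k (Suc i)) = h k * ((int M - int i + int k) * tcoeff M k i)"
      by (simp only: tcoeff_deriv)
    then show "int k * h k * tcoeff M k (Suc i) - (int d + 1 - int k) * h k * tcoeff M k i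
      = (int i + 1) * (h k * tcoeff M k (Suc i)) - (int d + 1 + int M - int i) * (h k * tcoeff M k i)"
      by (simp add: algebra_simps)
  qed
  finally show ?thesis
    by (simp only: sum_subtractf sum_distrib_left)
qed

text \<open>A form killed by the derivation modulo \<open>p\<close> is a multiple of \<open>(x + y)\<^sup>d\<close> as long as its degree
  stays below \<open>p\<close>, so lowering the degree by the derivation reduces everything to the
  non-vanishing of a single binomial coefficient.\<close>

lemma tcoeff_injective:
  assumes p: "prime p"
  shows "\<lbrakk>d + M < p; d < m; d < n; M + 2 * d + 2 \<le> m + n;
    \<And>i. i < m \<Longrightarrow> i \<le> d + M \<Longrightarrow> d + M - i < n \<Longrightarrow> int p dvd (\<Sum>k\<le>d. h k * tcoeff M k i); k \<le> d\<rbrakk>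
    \<Longrightarrow> int p dvd h k"
proof (induction d arbitrary: m n h k)
  have final: "int p dvd h k"
    if bin: "\<And>k. k \<le> d \<Longrightarrow> [h k = h 0 * int (d choose k)] (mod int p)" and "d + M < p" "d < m" "d < n"
      "M + 2 * d + 2 \<le> m + n" "k \<le> d"
      and h: "\<And>i. i < m \<Longrightarrow> i \<le> d + M \<Longrightarrow> d + M - i < n \<Longrightarrow> int p dvd (\<Sum>k\<le>d. h k * tcoeff M k i)"
    for d m n h k
  proof -
    \<comment> \<open>The largest exponent of x in a monomial of degree d + M outside (x^m, y^n);
      one exists by the bound on m + n. By \<open>bin\<close> the form is h 0 times (x + y)^d, so
      its product has the coefficient h 0 * binom(d + M, i) there, with a binomial coefficient prime
      to p.\<close>
    define i where "i = min (m - 1) (d + M)"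
    have i: "i < m" "i \<le> d + M" "d + M - i < n"
      using that by (auto simp: i_def min_def)
    have "[(\<Sum>k\<le>d. h k * tcoeff M k i) = (\<Sum>k\<le>d. h 0 * int (d choose k) * tcoeff M k i)] (mod int p)"
      by (intro cong_sum cong_scalar_right bin) auto
    also have "(\<Sum>k\<le>d. h 0 * int (d choose k) * tcoeff M k i) = h 0 * int ((d + M) choose i)"
      by (simp add: sum_choose_tcoeff[symmetric] sum_distrib_left mult.assoc)
    finally have "int p dvd h 0 * int ((d + M) choose i)"
      using h[OF i] by (simp add: cong_dvd_iff)
    then have "int p dvd h 0"
      using not_dvd_choose[OF p \<open>d + M < p\<close> i(2)] p
      by (simp add: prime_dvd_mult_iff)
    then have "int p dvd h 0 * int (d choose k)"
      by simp
    then show ?thesis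
      using bin[OF \<open>k \<le> d\<close>] by (simp add: cong_dvd_iff)
  qed
  {
    case 0
    then show ?case by (intro final[of 0 h m n]) auto
  next
    case (Suc d)
    define h' where "h' = (\<lambda>k. int (Suc k) * h (Suc k) - int (Suc d - k) * h k)"
    have h': "int p dvd h' k" if "k \<le> d" for k
    \<comment> \<open>The derived product at exponent i involves the exponents i and i + 1 of the
      original one, and both must survive. Hence m and n drop by 1, which the term 2 * d in the
      bound on m + n makes up for.\<close>
    proof (rule Suc.IH[of "m - 1" "n - 1" h'])
      fix i assume "i < m - 1" "i \<le> d + M" "d + M - i < n - 1"
      then have "int p dvd (\<Sum>k\<le>Suc d. h k * tcoeff M k (Suc i))" "int p dvd (\<Sum>k\<le>Suc d. h k * tcoeff M k i)"
        by (intro Suc.prems(5); linarith)+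
      then show "int p dvd (\<Sum>k\<le>d. h' k * tcoeff M k i)"
        unfolding h'_def sum_tcoeff_deriv by (intro dvd_diff dvd_mult)
    qed (use Suc.prems that in auto)
    \<comment> \<open>Vanishing of h' is the recursion of the binomial coefficients of degree d + 1;
      it can be solved modulo p because the divisors k + 1 \<le> d + 1 are below p.\<close>
    have bin: "[h k = h 0 * int (Suc d choose k)] (mod int p)" if "k \<le> Suc d" for k
      using that
    proof (induction k)
      case (Suc k)
      have "[int (Suc k) * h (Suc k) = int (Suc d - k) * h k] (mod int p)"
        using h'[of k] Suc.prems by (simp add: h'_def cong_iff_dvd_diff)
      also have "[int (Suc d - k) * h k = int (Suc d - k) * (h 0 * int (Suc d choose k))] (mod int p)"
        using Suc by (intro cong_scalar_left) auto
      also have "int (Suc d - k) * (h 0 * int (Suc d choose k)) = h 0 * int ((Suc d - k) * (Suc d choose k))"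
        by simp
      also have "(Suc d - k) * (Suc d choose k) = Suc k * (Suc d choose Suc k)"
        by (metis binomial_absorb_comp binomial_absorption mult.commute)
      also have "h 0 * int (Suc k * (Suc d choose Suc k)) = int (Suc k) * (h 0 * int (Suc d choose Suc k))"
        by (simp only: of_nat_mult mult_ac)
      finally have *: "[int (Suc k) * h (Suc k) = int (Suc k) * (h 0 * int (Suc d choose Suc k))] (mod int p)" .
      have "coprime (Suc k) p"
        using p Suc.prems \<open>Suc d + M < p\<close>
        by (metis add_lessD1 coprime_commute le_less_trans nat_dvd_not_less prime_imp_coprime zero_less_Suc)
      then have "coprime (int (Suc k)) (int p)"
        by (simp only: coprime_int_iff)
      then show ?case
        using * by (simp only: cong_mult_lcancel)
    qed simp
    show ?case
      by (rule final[OF bin Suc.prems(1-4,6)]) (use Suc.prems(5) in auto)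
  }
qed

text \<open>The exponents of \<open>x\<close> in the monomials of degree \<open>s\<close> outside \<open>(x\<^sup>m, y\<^sup>n)\<close>.\<close>

abbreviation band :: "nat \<Rightarrow> nat \<Rightarrow> nat \<Rightarrow> nat set" where
  "band s m n \<equiv> {i. i < m \<and> i \<le> s \<and> s - i < n}"

lemma band_finite: "finite (band s m n)"
  by (rule finite_subset[of _ "{..s}"]) auto

lemma card_band: "card (band s m n) \<le> min (min m n) (m + n - 1 - s)"
proof -
  have "band s m n = {s + 1 - n..<min m (s + 1)}"
    unfolding set_eq_iff mem_Collect_eq atLeastLessThan_iff by arith
  then have "card (band s m n) = min m (s + 1) - (s + 1 - n)"
    by simp
  then show ?thesis by arith
qed

text \<open>The multiple \<open>x\<^sup>j y\<^bsup>d - l\<^esup> (x + y)\<^bsup>p - M\<^esup>\<close> with leading exponent \<open>l\<close> is sent to \<open>0\<close>, because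
  \<open>(x + y)\<^sup>p = x\<^sup>p + y\<^sup>p\<close> lies in \<open>(x\<^sup>m, y\<^sup>n)\<close>.\<close>

lemma mod_image_tcoeff_drop_top:
  assumes p: "prime p" and "m \<le> p" "n \<le> p" "M \<le> p" "p - M \<le> l" "l \<le> d"
  shows "mod_image p {..<Suc l} (band (d + M) m n) (tcoeff M) \<subseteq> mod_image p {..<l} (band (d + M) m n) (tcoeff M)"
proof
  let ?T = "band (d + M) m n"
  fix f assume "f \<in> mod_image p {..<Suc l} ?T (tcoeff M)"
  then obtain h where f: "f = mod_map p {..<Suc l} ?T (tcoeff M) h"
    by (auto simp: mod_image_def)
  define e j where "e = p - M" and "j = l - (p - M)"
  define g where "g k = (if j \<le> k then int (e choose (k - j)) else 0)" for k
  have l: "l = j + e"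
    using assms by (simp add: e_def j_def)
  have g: "int p dvd (\<Sum>k<Suc l. g k * tcoeff M k i)" if i: "i \<in> ?T" for i
  proof -
    have "(\<Sum>k<Suc l. g k * tcoeff M k i) = (\<Sum>k\<in>{j..j + e}. g k * tcoeff M k i)"
      by (rule sum.mono_neutral_right) (auto simp: g_def l)
    also have "\<dots> = (\<Sum>k\<le>e. int (e choose k) * tcoeff M (k + j) i)"
      by (rule sum.reindex_bij_witness[where i = "\<lambda>k. k + j" and j = "\<lambda>k. k - j"]) (auto simp: g_def)
    also have "\<dots> = (if j \<le> i then int (p choose (i - j)) else 0)"
    proof (cases "j \<le> i")
      case True
      have "tcoeff M (k + j) i = tcoeff M k (i - j)" for k
        using True by (auto simp: tcoeff_def add.commute)
      then have "(\<Sum>k\<le>e. int (e choose k) * tcoeff M (k + j) i) = int ((e + M) choose (i - j))"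
        by (simp only: sum_choose_tcoeff)
      then show ?thesis using True assms by (simp add: e_def)
    qed (auto simp: tcoeff_def)
    \<comment> \<open>Of (x + y)^p only x^p and y^p remain modulo p. In the band neither is visible:
      i < m \<le> p excludes i = j + p, and at i = j the exponent of y is d - l + p \<ge> n.\<close>
    also have "int p dvd \<dots>"
    proof (cases "j < i")
      case True
      have "i - j < p"
        using i assms True by auto
      then have "p dvd (p choose (i - j))"
        using True p by (intro dvd_choose_prime) auto
      then show ?thesis by auto
    next
      case False
      have "i \<noteq> j"
        using i assms l by (auto simp: e_def)
      then show ?thesis using False by simp
    qed
    finally show ?thesis .
  qed
  \<comment> \<open>The relation g has leading coefficient 1 at l, so subtracting h l times g
    removes the exponent l from h without changing the image.\<close>
  have "f = mod_map p {..<l} ?T (tcoeff M) (\<lambda>k. h k - h l * g k)"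
  proof
    fix i
    have "(\<Sum>k<Suc l. (h k - h l * g k) * tcoeff M k i)
        = (\<Sum>k<Suc l. h k * tcoeff M k i) - h l * (\<Sum>k<Suc l. g k * tcoeff M k i)"
      by (simp only: left_diff_distrib sum_subtractf sum_distrib_left mult.assoc)
    moreover have "g l = 1"
      by (simp add: g_def l)
    ultimately have "(\<Sum>k<l. (h k - h l * g k) * tcoeff M k i)
        = (\<Sum>k<Suc l. h k * tcoeff M k i) - h l * (\<Sum>k<Suc l. g k * tcoeff M k i)"
      by simp
    then show "f i = mod_map p {..<l} ?T (tcoeff M) (\<lambda>k. h k - h l * g k) i"
      unfolding f mod_map_def using g[of i] by (auto simp: mod_eq_dvd_iff simp del: sum.lessThan_Suc)
  qed
  then show "f \<in> mod_image p {..<l} ?T (tcoeff M)"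
    by (simp add: mod_image_def)
qed

text \<open>The upper bounds come from the source, from the target, and from discarding all leading
  exponents l \<ge> p - M one after the other. They are sharp because for rank d' + 1 the forms
  divisible by a suitable monomial of degree d - d' are mapped injectively.\<close>

lemma card_mod_image_tcoeff:
  assumes p: "prime p" and "m \<le> p" "n \<le> p" "M \<le> p"
  shows "card (mod_image p {..d} (band (d + M) m n) (tcoeff M))
    = p ^ min (min (d + 1) (min (min m n) (p - M))) (m + n - M - 1 - d)"
    (is "card (mod_image p _ ?T _) = p ^ ?r")
proof (rule antisym)
  have p0: "p > 0" "p > 1"
    using p prime_gt_0_nat prime_gt_1_nat by blast+
  have pw: "p ^ i \<le> p ^ j" if "i \<le> j" for i j
    using that p0 by (simp add: power_increasing)
  have "card (mod_image p {..d} ?T (tcoeff M)) \<le> p ^ (d + 1)"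
    using card_mod_image_le_source[OF p0(1), of "{..d}" ?T] band_finite by simp
  moreover have "card (mod_image p {..d} ?T (tcoeff M)) \<le> p ^ min (min m n) (m + n - 1 - (d + M))"
    using card_mod_image_le_target[OF p0(1) band_finite] pw[OF card_band] by (rule le_trans)
  moreover have "card (mod_image p {..d} ?T (tcoeff M)) \<le> p ^ (p - M)" if "p - M \<le> d"
  proof -
    have "mod_image p {..<Suc l} ?T (tcoeff M) \<subseteq> mod_image p {..<p - M} ?T (tcoeff M)" if "p - M \<le> l" "l \<le> d" for l
      using that
    proof (induction l rule: dec_induct)
      case base
      then show ?case using mod_image_tcoeff_drop_top[OF assms] by simp
    next
      case (step l)
      then show ?case using mod_image_tcoeff_drop_top[OF assms, of "Suc l" d] by force
    qed
    then have "mod_image p {..d} ?T (tcoeff M) \<subseteq> mod_image p {..<p - M} ?T (tcoeff M)"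
      using that by (simp add: lessThan_Suc_atMost)
    then have "card (mod_image p {..d} ?T (tcoeff M)) \<le> card (mod_image p {..<p - M} ?T (tcoeff M))"
      by (intro card_mono finite_mod_image p0 band_finite)
    also have "\<dots> \<le> p ^ (p - M)"
      using card_mod_image_le_source[OF p0(1), of "{..<p - M}" ?T] band_finite by simp
    finally show ?thesis .
  qed
  moreover have "p ^ (d + 1) \<le> p ^ (p - M)" if "\<not> p - M \<le> d"
    using that by (intro pw) simp
  moreover have "p ^ ?r = min (min (p ^ (d + 1)) (p ^ (p - M))) (p ^ min (min m n) (m + n - 1 - (d + M)))"
  proof -
    have "mono ((^) p)" by (intro monoI pw)
    moreover have "?r = min (min (d + 1) (p - M)) (min (min m n) (m + n - 1 - (d + M)))"
      by (simp add: ac_simps diff_diff_left)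
    ultimately show ?thesis
      by (simp only: min_of_mono)
  qed
  ultimately show "card (mod_image p {..d} ?T (tcoeff M)) \<le> p ^ ?r"
    by (cases "p - M \<le> d") auto
next
  have p0: "p > 0"
    using p by (simp_all add: prime_gt_0_nat)
  show "p ^ ?r \<le> card (mod_image p {..d} ?T (tcoeff M))"
  proof (cases ?r)
    case 0
    have "mod_image p {..d} ?T (tcoeff M) \<noteq> {}" by (simp add: mod_image_def)
    then show ?thesis
      using 0 by (simp add: Suc_le_eq card_gt_0_iff finite_mod_image[OF p0 band_finite])
  next
    case (Suc d')
    \<comment> \<open>Test on the multiples of \<open>x\<^sup>j y\<^bsup>d - d' - j\<^esup>\<close>: dividing by this monomial leaves forms of degree \<open>d'\<close>
      modulo \<open>(x\<^bsup>m - j\<^esup>, y\<^bsup>n - (d - d' - j)\<^esup>)\<close>.\<close>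
    define j where "j = min (d - d') (m - d' - 1)"
    have d': "d' \<le> d" "d' < m" "d' < n" "d' + M < p" "M + d + d' + 2 \<le> m + n"
      using Suc assms by (auto simp: min_def split: if_splits)
    \<comment> \<open>The exponent j takes as much of the degree d - d' as the bound x^m permits,
      and y takes the rest. The size of m + n then leaves enough room on the y side for the
      injectivity in degree d'.\<close>
    have j: "j + d' \<le> d" "d' < m - j" "d' < n - (d - d' - j)"
      "M + 2 * d' + 2 \<le> m - j + (n - (d - d' - j))" "d - d' - j \<le> n" "j \<le> m"
      using d' by (auto simp: j_def min_def)
    have "p ^ card {j..j + d'} \<le> card (mod_image p {j..j + d'} ?T (tcoeff M))"
    proof (rule card_mod_image_ge_source[OF p0 _ band_finite])
      fix h \<sigma> assume h: "\<And>\<tau>. \<tau> \<in> ?T \<Longrightarrow> int p dvd (\<Sum>\<sigma>\<in>{j..j + d'}. h \<sigma> * tcoeff M \<sigma> \<tau>)" and "\<sigma> \<in> {j..j + d'}"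
      have "int p dvd h (\<sigma> - j + j)"
      proof (rule tcoeff_injective[OF p d'(4) j(2-4), where h = "\<lambda>k. h (k + j)"])
        fix i assume i: "i < m - j" "i \<le> d' + M" "d' + M - i < n - (d - d' - j)"
        have "int p dvd (\<Sum>\<sigma>\<in>{j..j + d'}. h \<sigma> * tcoeff M \<sigma> (i + j))"
          by (rule h) (use i j in auto)
        also have "(\<Sum>\<sigma>\<in>{j..j + d'}. h \<sigma> * tcoeff M \<sigma> (i + j)) = (\<Sum>k\<le>d'. h (k + j) * tcoeff M k i)"
          by (rule sum.reindex_bij_witness[where i = "\<lambda>k. k + j" and j = "\<lambda>k. k - j"]) (auto simp: tcoeff_def)
        finally show "int p dvd (\<Sum>k\<le>d'. h (k + j) * tcoeff M k i)" .
      qed (use \<open>\<sigma> \<in> _\<close> in auto)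
      then show "int p dvd h \<sigma>"
        using \<open>\<sigma> \<in> _\<close> by simp
    qed simp
    also have "\<dots> \<le> card (mod_image p {..d} ?T (tcoeff M))"
      using j by (intro card_mono finite_mod_image p0 band_finite mod_image_mono_source) auto
    finally show ?thesis
      using Suc by simp
  qed
qed

section \<open>Multiplication by a power of \<open>g\<close>\<close>

text \<open>Sources that hit nothing can be added. This allows the exponents in a box to be replaced
  by complete sets of monomials of given degree, which stick out of it.\<close>

lemma mod_image_source_extend:
  assumes "finite S" "S' \<subseteq> S" "\<And>\<sigma> \<tau>. \<sigma> \<in> S \<Longrightarrow> \<sigma> \<notin> S' \<Longrightarrow> \<tau> \<in> T \<Longrightarrow> w \<sigma> \<tau> = 0"
  shows "mod_image p S T w = mod_image p S' T w"
proof -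
  have "(\<Sum>\<sigma>\<in>S. h \<sigma> * w \<sigma> \<tau>) = (\<Sum>\<sigma>\<in>S'. h \<sigma> * w \<sigma> \<tau>)" if "\<tau> \<in> T" for h \<tau>
    using assms that by (intro sum.mono_neutral_right) auto
  then have "mod_map p S T w = mod_map p S' T w"
    by (auto simp: mod_map_def fun_eq_iff)
  then show ?thesis by (simp add: mod_image_def)
qed

section \<open>Powers of g modulo p and the Frobenius map\<close>

text \<open>Comparison of coefficients in (1 + X)^(pM) = (1 + X^p)^M modulo p. Induction on M: in
  the convolution with (1 + X)^p only the terms 0 and p survive, and these two combine by Pascal's
  rule.\<close>

lemma choose_mult_prime_cong:
  assumes p: "prime p"
  shows "[(p * M) choose k = (if p dvd k then M choose (k div p) else 0)] (mod p)"
proof (induction M arbitrary: k)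
  case 0
  have "p > 0" using p by (rule prime_gt_0_nat)
  then have "k div p \<noteq> 0" if "p dvd k" "k \<noteq> 0"
    using that by auto
  then show ?case by (cases "k = 0") (auto simp: binomial_eq_0)
next
  case (Suc M)
  have p0: "p > 0" using p by (rule prime_gt_0_nat)
  have "[(\<Sum>j\<le>k. (p choose j) * ((p * M) choose (k - j)))
      = (\<Sum>j\<le>k. if j \<in> {0, p} then (p * M) choose (k - j) else 0)] (mod p)"
  proof (rule cong_sum)
    fix j
    have "p dvd (p choose j)" if "j \<notin> {0, p}"
    proof (cases "j < p")
      case True
      then show ?thesis using p that by (intro dvd_choose_prime) auto
    next
      case False
      then show ?thesis using that by (simp add: binomial_eq_0)
    qed
    then show "[(p choose j) * ((p * M) choose (k - j)) = (if j \<in> {0, p} then (p * M) choose (k - j) else 0)] (mod p)"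
      by (auto simp: cong_0_iff)
  qed
  also have "(\<Sum>j\<le>k. if j \<in> {0, p} then (p * M) choose (k - j) else 0)
      = (\<Sum>j\<in>{..k} \<inter> {0, p}. (p * M) choose (k - j))"
    by (rule sum.inter_restrict[symmetric]) simp
  also have "{..k} \<inter> {0, p} = (if p \<le> k then {0, p} else {0})"
    by auto
  also have "(\<Sum>j\<in>(if p \<le> k then {0, p} else {0}). (p * M) choose (k - j))
      = ((p * M) choose k) + (if p \<le> k then (p * M) choose (k - p) else 0)"
    using p0 by auto
  also have "[\<dots> = (if p dvd k then M choose (k div p) else 0)
      + (if p \<le> k then if p dvd (k - p) then M choose ((k - p) div p) else 0 else 0)] (mod p)"
    using Suc.IH by (intro cong_add) auto
  also have "(if p dvd k then M choose (k div p) else 0)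
      + (if p \<le> k then if p dvd (k - p) then M choose ((k - p) div p) else 0 else 0)
      = (if p dvd k then Suc M choose (k div p) else 0)"
  proof (cases "p dvd k")
    case True
    then obtain l where l: "k = p * l" by blast
    show ?thesis
    proof (cases l)
      case 0
      then show ?thesis using l p0 by simp
    next
      case (Suc l')
      have "k - p = p * l'" using l Suc by simp
      then show ?thesis using l Suc p0 by simp
    qed
  next
    case False
    then show ?thesis
      using p0 by (auto simp: dvd_minus_self)
  qed
  finally show ?case
    by (simp only: vandermonde[symmetric] mult_Suc_right)
qed

text \<open>The coefficient of \<open>x\<^sup>i y\<^sup>j\<close> in the \<open>N\<close>-th power of \<open>poly_g a b c u v\<close>.\<close>

definition gcoeff :: "nat \<Rightarrow> nat \<Rightarrow> nat \<Rightarrow> nat \<Rightarrow> nat \<Rightarrow> nat \<Rightarrow> nat \<Rightarrow> nat \<Rightarrow> int" where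
  "gcoeff a b c u v N i j =
    (\<Sum>k\<le>c * N. if i = a * N + u * k \<and> j = b * N + v * (c * N - k) then int ((c * N) choose k) else 0)"

lemma gcoeff_eq:
  assumes "u > 0" "k \<le> c * N"
  shows "gcoeff a b c u v N (a * N + u * k) (b * N + v * (c * N - k)) = int ((c * N) choose k)"
proof -
  have "gcoeff a b c u v N (a * N + u * k) (b * N + v * (c * N - k))
      = (\<Sum>k'\<le>c * N. if k' = k then int ((c * N) choose k) else 0)"
    unfolding gcoeff_def using assms(1) by (intro sum.cong) auto
  then show ?thesis using assms by simp
qed

lemma gcoeff_nonzeroE:
  assumes "gcoeff a b c u v N i j \<noteq> 0"
  obtains k where "k \<le> c * N" "i = a * N + u * k" "j = b * N + v * (c * N - k)"
proof -
  have "\<exists>k\<le>c * N. i = a * N + u * k \<and> j = b * N + v * (c * N - k)"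
  proof (rule ccontr)
    assume "\<not> ?thesis"
    then have "gcoeff a b c u v N i j = 0"
      unfolding gcoeff_def by (intro sum.neutral) auto
    then show False using assms by simp
  qed
  then show ?thesis using that by blast
qed

text \<open>Modulo p the power g^(pN) is g^N evaluated at (x^p, y^p), so its support consists of
  p-fold exponents.\<close>

lemma gcoeff_prime_nonzeroE:
  assumes p: "prime p" and "u > 0" and nz: "\<not> int p dvd gcoeff a b c u v (p * N) i j"
  obtains k where "k \<le> c * N" "i = p * (a * N + u * k)" "j = p * (b * N + v * (c * N - k))"
proof -
  obtain k where k: "k \<le> c * (p * N)" "i = a * (p * N) + u * k" "j = b * (p * N) + v * (c * (p * N) - k)"
    using nz gcoeff_nonzeroE by (metis dvd_0_right)
  have "\<not> p dvd (p * (c * N)) choose k"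
    using nz gcoeff_eq[OF assms(2) k(1), of a b v] k(2,3) by (simp add: mult.left_commute)
  then have "p dvd k"
    using choose_mult_prime_cong[OF p, of "c * N" k] by (auto simp: cong_0_iff split: if_splits)
  then obtain l where l: "k = p * l" by blast
  have "p > 0" using p by (rule prime_gt_0_nat)
  have "c * (p * N) - k = p * (c * N - l)"
    unfolding l by (simp add: diff_mult_distrib2 mult_ac)
  then show thesis
    using that[of l] k l \<open>p > 0\<close> by (simp add: algebra_simps)
qed

lemma gcoeff_frobenius:
  assumes p: "prime p" and "u > 0"
  shows "[gcoeff a b c u v (p * N) (p * i) (p * j) = gcoeff a b c u v N i j] (mod int p)"
proof (cases "\<exists>k\<le>c * N. i = a * N + u * k \<and> j = b * N + v * (c * N - k)")
  case True
  then obtain k where k: "k \<le> c * N" "i = a * N + u * k" "j = b * N + v * (c * N - k)" by blast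
  have p0: "p > 0" using p by (rule prime_gt_0_nat)
  have *: "p * i = a * (p * N) + u * (p * k)" "p * j = b * (p * N) + v * (c * (p * N) - p * k)" "p * k \<le> c * (p * N)"
    using k by (simp_all add: algebra_simps)
  have "gcoeff a b c u v (p * N) (p * i) (p * j) = int ((c * (p * N)) choose (p * k))"
    unfolding *(1,2) by (rule gcoeff_eq[OF assms(2) *(3)])
  moreover have "gcoeff a b c u v N i j = int ((c * N) choose k)"
    unfolding k(2,3) by (rule gcoeff_eq[OF assms(2) k(1)])
  moreover have "[(p * (c * N)) choose (p * k) = (c * N) choose k] (mod p)"
    using choose_mult_prime_cong[OF p, of "c * N" "p * k"] p0 by simp
  ultimately show ?thesis
    by (simp add: cong_int_iff mult.left_commute)
next
  case False
  have p0: "p > 0" using p by (rule prime_gt_0_nat)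
  have "gcoeff a b c u v N i j = 0"
    using False gcoeff_nonzeroE by metis
  moreover have "int p dvd gcoeff a b c u v (p * N) (p * i) (p * j)"
    using False p0 by (rule_tac ccontr) (auto elim!: gcoeff_prime_nonzeroE[OF assms])
  ultimately show ?thesis by (simp add: cong_0_iff)
qed

abbreviation box :: "nat \<Rightarrow> (nat \<times> nat) set" where
  "box q \<equiv> {..<q} \<times> {..<q}"

text \<open>The matrix of multiplication by G on monomials. Restricted to \<open>box q\<close> on
  both sides it describes multiplication on R/(x^q, y^q). The guard excludes truncated differences
  of exponents.\<close>

definition shift_weight :: "(nat \<Rightarrow> nat \<Rightarrow> int) \<Rightarrow> nat \<times> nat \<Rightarrow> nat \<times> nat \<Rightarrow> int" where
  "shift_weight G \<sigma> \<tau> =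
    (if fst \<sigma> \<le> fst \<tau> \<and> snd \<sigma> \<le> snd \<tau> then G (fst \<tau> - fst \<sigma>) (snd \<tau> - snd \<sigma>) else 0)"

lemma residue_unique:
  fixes u :: nat
  assumes "\<alpha> + u * k = \<alpha>' + u * k'" "\<alpha> < u" "\<alpha>' < u"
  shows "\<alpha> = \<alpha>'" "k = k'"
proof -
  have "(\<alpha> + u * k) mod u = (\<alpha>' + u * k') mod u" "(\<alpha> + u * k) div u = (\<alpha>' + u * k') div u"
    by (simp_all only: assms(1))
  then show "\<alpha> = \<alpha>'" "k = k'"
    using assms(2,3) by simp_all
qed

text \<open>Sorted by the residues of both exponents modulo p, the monomials split into p^2 classes.
  Multiplication by g^(pN), a series in x^p and y^p modulo p, preserves each class and acts on it as
  g^N acts on the smaller box.\<close>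

lemma card_mod_image_frobenius:
  assumes p: "prime p" and "u > 0"
  shows "card (mod_image p (box (p * q)) (box (p * q)) (shift_weight (gcoeff a b c u v (p * N))))
    = card (mod_image p (box q) (box q) (shift_weight (gcoeff a b c u v N))) ^ p\<^sup>2"
proof -
  let ?w = "shift_weight (gcoeff a b c u v (p * N))"
  define f where "f = (\<lambda>(\<alpha>, \<beta>) (i, j). (\<alpha> + p * i, \<beta> + p * j))"
  have p0: "p > 0" using p by (rule prime_gt_0_nat)
  have f_inj: "\<iota> = \<iota>' \<and> x = x'" if "f \<iota> x = f \<iota>' x'" "\<iota> \<in> box p" "\<iota>' \<in> box p" for \<iota> \<iota>' x x'
  proof -
    obtain \<alpha> \<beta> \<alpha>' \<beta>' i j i' j' where [simp]: "\<iota> = (\<alpha>, \<beta>)" "\<iota>' = (\<alpha>', \<beta>')" "x = (i, j)" "x' = (i', j')"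
      by (metis prod.exhaust)
    have eq: "\<alpha> + p * i = \<alpha>' + p * i'" "\<beta> + p * j = \<beta>' + p * j'" "\<alpha> < p" "\<alpha>' < p" "\<beta> < p" "\<beta>' < p"
      using that by (auto simp: f_def)
    then show ?thesis
      using residue_unique[OF eq(1,3,4)] residue_unique[OF eq(2,5,6)] by simp
  qed
  have less: "\<alpha> + p * i < p * q" if "\<alpha> < p" "i < q" for \<alpha> i
  proof -
    have "p * Suc i \<le> p * q" using that by (intro mult_le_mono) auto
    then show ?thesis using that by simp
  qed
  have "card (mod_image p (box (p * q)) (box (p * q)) ?w) = (\<Prod>\<iota>\<in>box p. card (mod_image p (f \<iota> ` box q) (f \<iota> ` box q) ?w))"
  proof (rule card_mod_image_blocks)
    show "f \<iota> ` box q \<subseteq> box (p * q)" if "\<iota> \<in> box p" for \<iota>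
      using that less by (auto simp: f_def)
    show "box (p * q) = (\<Union>\<iota>\<in>box p. f \<iota> ` box q)"
    proof (intro equalityI subsetI)
      fix x assume x: "x \<in> box (p * q)"
      then have "x = f (fst x mod p, snd x mod p) (fst x div p, snd x div p)"
        by (auto simp: f_def)
      moreover have "(fst x div p, snd x div p) \<in> box q" "(fst x mod p, snd x mod p) \<in> box p"
        using x p0 by (auto simp: less_mult_imp_div_less mult.commute)
      ultimately show "x \<in> (\<Union>\<iota>\<in>box p. f \<iota> ` box q)" by blast
    qed (use less in \<open>auto simp: f_def\<close>)
    show "disjoint_family_on (\<lambda>\<iota>. f \<iota> ` box q) (box p)"
      unfolding disjoint_family_on_def using f_inj by blast
    then show "disjoint_family_on (\<lambda>\<iota>. f \<iota> ` box q) (box p)" .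
    show "int p dvd ?w \<sigma> \<tau>"
      if \<iota>: "\<iota> \<in> box p" and \<sigma>: "\<sigma> \<in> f \<iota> ` box q" and \<tau>: "\<tau> \<in> box (p * q)" "\<tau> \<notin> f \<iota> ` box q" for \<iota> \<sigma> \<tau>
    proof (rule ccontr)
      assume nz: "\<not> int p dvd ?w \<sigma> \<tau>"
      obtain \<alpha> \<beta> i j where \<sigma>': "\<iota> = (\<alpha>, \<beta>)" "\<sigma> = (\<alpha> + p * i, \<beta> + p * j)"
        using \<sigma> by (auto simp: f_def split: prod.splits)
      have le: "fst \<sigma> \<le> fst \<tau>" "snd \<sigma> \<le> snd \<tau>"
        using nz by (auto simp: shift_weight_def split: if_splits)
      then have "\<not> int p dvd gcoeff a b c u v (p * N) (fst \<tau> - fst \<sigma>) (snd \<tau> - snd \<sigma>)"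
        using nz by (simp add: shift_weight_def)
      then obtain k l where "fst \<tau> - fst \<sigma> = p * k" "snd \<tau> - snd \<sigma> = p * l"
        using gcoeff_prime_nonzeroE[OF assms] by metis
      then have "fst \<tau> = fst \<sigma> + p * k" "snd \<tau> = snd \<sigma> + p * l"
        using le by linarith+
      then have eq: "\<tau> = (\<alpha> + p * (i + k), \<beta> + p * (j + l))"
        unfolding \<sigma>' by (intro prod_eqI) (simp_all add: distrib_left)
      have "\<alpha> + p * (i + k) < p * q" "\<beta> + p * (j + l) < p * q"
        using \<tau>(1) unfolding eq by auto
      then have "p * (i + k) < p * q" "p * (j + l) < p * q"
        by linarith+
      then have "(i + k, j + l) \<in> box q"
        by simp
      then show False
        using \<tau>(2) unfolding eq \<sigma>'(1) f_def by force
    qed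
  qed auto
  also have "\<dots> = (\<Prod>\<iota>\<in>box p. card (mod_image p (box q) (box q) (shift_weight (gcoeff a b c u v N))))"
  proof (rule prod.cong[OF refl])
    fix \<iota> assume "\<iota> \<in> box p"
    have inj: "inj_on (f \<iota>) (box q)"
      using f_inj \<open>\<iota> \<in> box p\<close> by (auto intro: inj_onI)
    have "[?w (f \<iota> \<sigma>) (f \<iota> \<tau>) = shift_weight (gcoeff a b c u v N) \<sigma> \<tau>] (mod int p)" for \<sigma> \<tau>
    proof -
      have "?w (f \<iota> \<sigma>) (f \<iota> \<tau>) = (if fst \<sigma> \<le> fst \<tau> \<and> snd \<sigma> \<le> snd \<tau>
          then gcoeff a b c u v (p * N) (p * (fst \<tau> - fst \<sigma>)) (p * (snd \<tau> - snd \<sigma>)) else 0)"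
        using p0 by (auto simp: shift_weight_def f_def diff_mult_distrib2 split: prod.splits)
      then show ?thesis
        using gcoeff_frobenius[OF assms] by (simp add: shift_weight_def)
    qed
    then show "card (mod_image p (f \<iota> ` box q) (f \<iota> ` box q) ?w)
        = card (mod_image p (box q) (box q) (shift_weight (gcoeff a b c u v N)))"
      unfolding card_mod_image_reindex[OF inj inj] by (intro arg_cong[where f = card] mod_image_mod_cong)
  qed
  finally show ?thesis
    by (simp add: power2_eq_square)
qed

section \<open>Reduction to powers of x + y for q = p\<close>

text \<open>The quotient l / u rounded up, that is, the number of k with u * k < l; it is 0 for l =
  0, which suits truncated arguments.\<close>

definition slice :: "nat \<Rightarrow> nat \<Rightarrow> nat" where
  "slice u l = (l + u - 1) div u"

lemma less_slice_iff:
  assumes "u > 0"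
  shows "k < slice u l \<longleftrightarrow> u * k < l"
proof -
  have "k < slice u l \<longleftrightarrow> Suc k * u \<le> l + u - 1"
    unfolding slice_def Suc_le_eq[symmetric] using assms by (simp add: less_eq_div_iff_mult_less_eq)
  then show ?thesis using assms by (auto simp: mult.commute)
qed

text \<open>Write a monomial as x^\<alpha> y^\<beta> X^k Y^l with X = x^u, Y = y^v, \<alpha> < u,
  \<beta> < v. Multiplication by g^N fixes \<alpha> and \<beta>, shifts by x^(aN) y^(bN) and
  multiplies by (X + Y)^(cN), so it is a direct sum over \<alpha>, \<beta> and the degree d = k + l.
  Vanishing of x^p and y^p becomes vanishing of X^m and Y^n for the two slices.\<close>

lemma card_mod_image_gcoeff:
  assumes p: "prime p" and uv: "u > 0" "v > 0" and M: "c * N \<le> p"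
  shows "card (mod_image p (box p) (box p) (shift_weight (gcoeff a b c u v N)))
    = p ^ (\<Sum>\<alpha><u. \<Sum>\<beta><v. \<Sum>d<2 * p.
        min (min (d + 1) (min (min (slice u (p - a * N - \<alpha>)) (slice v (p - b * N - \<beta>))) (p - c * N)))
          (slice u (p - a * N - \<alpha>) + slice v (p - b * N - \<beta>) - c * N - 1 - d))"
    (is "_ = p ^ (\<Sum>\<alpha><u. \<Sum>\<beta><v. \<Sum>d<2 * p. ?r \<alpha> \<beta> d)")
proof -
  let ?w = "shift_weight (gcoeff a b c u v N)"
  define M where "M = c * N"
  define m where "m \<alpha> = slice u (p - a * N - \<alpha>)" for \<alpha>
  define n where "n \<beta> = slice v (p - b * N - \<beta>)" for \<beta>
  \<comment> \<open>For i, j < p the degree i div u + j div v is below 2 * p, so these blocks cover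
    the box.\<close>
  define I where "I = {..<u} \<times> {..<v} \<times> {..<2 * p}"
  define f where "f = (\<lambda>(\<alpha>, \<beta>, d) k. (\<alpha> + u * k, \<beta> + v * (d - k)))"
  \<comment> \<open>The target index absorbs the shift by aN and bN, so that in every block only the
    matrix \<open>tcoeff M\<close> is left.\<close>
  define g where "g = (\<lambda>(\<alpha>, \<beta>, d) i. (\<alpha> + u * i + a * N, \<beta> + v * (d + M - i) + b * N))"
  define B where "B = (\<lambda>(\<alpha>, \<beta>, d). band (d + M) (m \<alpha>) (n \<beta>))"
  define D where "D = (\<lambda>(\<alpha> :: nat, \<beta> :: nat, d). {..d :: nat})"
  \<comment> \<open>All monomials of each degree, also those outside the box. They give every block
    the full source {..d}; exponents never decrease, so the additional ones contribute nothing to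
    the target box.\<close>
  define S where "S = (\<Union>\<iota>\<in>I. f \<iota> ` D \<iota>)"
  have p0: "p > 0" using p by (rule prime_gt_0_nat)
  have m: "i < m \<alpha> \<longleftrightarrow> \<alpha> + u * i + a * N < p" for i \<alpha>
    unfolding m_def less_slice_iff[OF uv(1)] by auto
  have n: "i < n \<beta> \<longleftrightarrow> \<beta> + v * i + b * N < p" for i \<beta>
    unfolding n_def less_slice_iff[OF uv(2)] by auto
  have mp: "m \<alpha> \<le> p" for \<alpha>
  proof (rule ccontr)
    assume "\<not> m \<alpha> \<le> p"
    then have "\<alpha> + u * p + a * N < p" using m[of p \<alpha>] by simp
    then show False using uv(1) by (cases u) auto
  qed
  have np: "n \<beta> \<le> p" for \<beta>
  proof (rule ccontr)
    assume "\<not> n \<beta> \<le> p"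
    then have "\<beta> + v * p + b * N < p" using n[of p \<beta>] by simp
    then show False using uv(2) by (cases v) auto
  qed
  have finS: "finite S"
    by (auto simp: S_def I_def D_def)
  have subS: "box p \<subseteq> S"
  proof
    fix x assume "x \<in> box p"
    then obtain i j where x: "x = (i, j)" "i < p" "j < p" by auto
    have "i div u \<le> i" "j div v \<le> j" by simp_all
    then have "i div u + j div v < 2 * p"
      using x by linarith
    then have "(i mod u, j mod v, i div u + j div v) \<in> I"
      using x uv by (auto simp: I_def)
    moreover have "x = f (i mod u, j mod v, i div u + j div v) (i div u)"
      by (simp add: f_def x)
    moreover have "i div u \<in> D (i mod u, j mod v, i div u + j div v)"
      by (simp add: D_def)
    ultimately show "x \<in> S" unfolding S_def by blast
  qed
  have f_inj: "\<iota> = \<iota>' \<and> k = k'" if "f \<iota> k = f \<iota>' k'" "\<iota> \<in> I" "\<iota>' \<in> I" "k \<in> D \<iota>" "k' \<in> D \<iota>'" for \<iota> \<iota>' k k'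
  proof -
    obtain \<alpha> \<beta> d \<alpha>' \<beta>' d' where [simp]: "\<iota> = (\<alpha>, \<beta>, d)" "\<iota>' = (\<alpha>', \<beta>', d')"
      by (metis prod_cases3)
    have eq: "\<alpha> + u * k = \<alpha>' + u * k'" "\<beta> + v * (d - k) = \<beta>' + v * (d' - k')" "\<alpha> < u" "\<alpha>' < u" "\<beta> < v" "\<beta>' < v" "k \<le> d" "k' \<le> d'"
      using that by (auto simp: f_def I_def D_def)
    then show ?thesis
      using residue_unique[OF eq(1,3,4)] residue_unique[OF eq(2,5,6)] by simp
  qed
  have g_inj: "\<iota> = \<iota>' \<and> k = k'" if "g \<iota> k = g \<iota>' k'" "\<iota> \<in> I" "\<iota>' \<in> I" "k \<in> B \<iota>" "k' \<in> B \<iota>'" for \<iota> \<iota>' k k'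
  proof -
    obtain \<alpha> \<beta> d \<alpha>' \<beta>' d' where [simp]: "\<iota> = (\<alpha>, \<beta>, d)" "\<iota>' = (\<alpha>', \<beta>', d')"
      by (metis prod_cases3)
    have eq: "\<alpha> + u * k = \<alpha>' + u * k'" "\<beta> + v * (d + M - k) = \<beta>' + v * (d' + M - k')" "\<alpha> < u" "\<alpha>' < u" "\<beta> < v" "\<beta>' < v" "k \<le> d + M" "k' \<le> d' + M"
      using that by (auto simp: g_def I_def B_def)
    then show ?thesis
      using residue_unique[OF eq(1,3,4)] residue_unique[OF eq(2,5,6)] by simp
  qed
  have hit: "\<exists>i\<le>M. \<tau> = g \<iota> (k + i)" if "\<iota> \<in> I" "k \<in> D \<iota>" and nz: "?w (f \<iota> k) \<tau> \<noteq> 0" for \<iota> k \<tau>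
  proof -
    obtain \<alpha> \<beta> d where [simp]: "\<iota> = (\<alpha>, \<beta>, d)"
      by (metis prod_cases3)
    have kd: "k \<le> d" using that by (simp add: D_def)
    have le: "fst (f \<iota> k) \<le> fst \<tau>" "snd (f \<iota> k) \<le> snd \<tau>"
      using nz by (auto simp: shift_weight_def split: if_splits)
    then have "gcoeff a b c u v N (fst \<tau> - fst (f \<iota> k)) (snd \<tau> - snd (f \<iota> k)) \<noteq> 0"
      using nz by (simp add: shift_weight_def)
    then obtain i where i: "i \<le> M" "fst \<tau> - fst (f \<iota> k) = a * N + u * i" "snd \<tau> - snd (f \<iota> k) = b * N + v * (M - i)"
      unfolding M_def by (rule gcoeff_nonzeroE)
    have "d + M - (k + i) = (d - k) + (M - i)"
      using kd i(1) by simp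
    then have "fst (g \<iota> (k + i)) = fst (f \<iota> k) + (a * N + u * i)"
      "snd (g \<iota> (k + i)) = snd (f \<iota> k) + (b * N + v * (M - i))"
      by (simp_all add: f_def g_def distrib_left)
    moreover have "fst \<tau> = fst (f \<iota> k) + (a * N + u * i)"
      "snd \<tau> = snd (f \<iota> k) + (b * N + v * (M - i))"
      using i(2,3) le by linarith+
    ultimately have "\<tau> = g \<iota> (k + i)"
      by (intro prod_eqI) simp_all
    then show ?thesis using i(1) by blast
  qed
  have "card (mod_image p (box p) (box p) ?w) = card (mod_image p S (box p) ?w)"
    by (subst mod_image_source_extend[OF finS subS]) (auto simp: shift_weight_def)
  also have "\<dots> = (\<Prod>\<iota>\<in>I. card (mod_image p (f \<iota> ` D \<iota>) (g \<iota> ` B \<iota>) ?w))"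
  proof (rule card_mod_image_blocks)
    show "g \<iota> ` B \<iota> \<subseteq> box p" if "\<iota> \<in> I" for \<iota>
      using that by (auto simp: g_def B_def m n)
    show "disjoint_family_on (\<lambda>\<iota>. f \<iota> ` D \<iota>) I"
      unfolding disjoint_family_on_def using f_inj by blast
    show "disjoint_family_on (\<lambda>\<iota>. g \<iota> ` B \<iota>) I"
      unfolding disjoint_family_on_def using g_inj by blast
    show "int p dvd ?w \<sigma> \<tau>"
      if \<iota>: "\<iota> \<in> I" and \<sigma>: "\<sigma> \<in> f \<iota> ` D \<iota>" and \<tau>: "\<tau> \<in> box p" "\<tau> \<notin> g \<iota> ` B \<iota>" for \<iota> \<sigma> \<tau>
    proof (rule ccontr)
      assume "\<not> int p dvd ?w \<sigma> \<tau>"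
      then have nz: "?w \<sigma> \<tau> \<noteq> 0" by auto
      obtain k where k: "\<sigma> = f \<iota> k" "k \<in> D \<iota>" using \<sigma> by blast
      obtain i where i: "i \<le> M" "\<tau> = g \<iota> (k + i)"
        using hit[OF \<iota> k(2)] nz k(1) by blast
      have "k + i \<in> B \<iota>"
        using \<tau>(1) k(2) i by (auto simp: g_def B_def D_def m n split: prod.splits)
      then show False using \<tau>(2) i(2) by blast
    qed
  qed (use finS in \<open>auto simp: I_def S_def\<close>)
  also have "\<dots> = (\<Prod>\<iota>\<in>I. p ^ (case \<iota> of (\<alpha>, \<beta>, d) \<Rightarrow> ?r \<alpha> \<beta> d))"
  proof (rule prod.cong[OF refl])
    fix \<iota> assume \<iota>: "\<iota> \<in> I"
    obtain \<alpha> \<beta> d where \<iota>_eq: "\<iota> = (\<alpha>, \<beta>, d)"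
      by (metis prod_cases3)
    have inj: "inj_on (f \<iota>) (D \<iota>)" "inj_on (g \<iota>) (B \<iota>)"
      using f_inj[OF _ \<iota> \<iota>] g_inj[OF _ \<iota> \<iota>] by (auto intro!: inj_onI)
    have w: "?w (f \<iota> k) (g \<iota> i) = tcoeff M k i" if k: "k \<in> D \<iota>" and i: "i \<in> B \<iota>" for k i
    proof (cases "k \<le> i \<and> i - k \<le> M")
      case True
      have kd: "k \<le> d" "i \<le> d + M" using k i by (simp_all add: D_def B_def \<iota>_eq)
      have *: "d + M - i = (d - k) + (M - (i - k))" "i = k + (i - k)"
        using kd True by arith+
      have "u * i = u * k + u * (i - k)"
        using *(2) by (metis distrib_left)
      then have "fst (g \<iota> i) = fst (f \<iota> k) + (a * N + u * (i - k))"
        unfolding \<iota>_eq f_def g_def by simp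
      moreover have "snd (g \<iota> i) = snd (f \<iota> k) + (b * N + v * (M - (i - k)))"
        unfolding \<iota>_eq f_def g_def prod.case snd_conv *(1) by (simp only: distrib_left add_ac)
      ultimately have "?w (f \<iota> k) (g \<iota> i) = gcoeff a b c u v N (a * N + u * (i - k)) (b * N + v * (M - (i - k)))"
        by (simp add: shift_weight_def)
      also have "\<dots> = int (M choose (i - k))"
        unfolding M_def using True by (intro gcoeff_eq uv) (simp add: M_def)
      finally show ?thesis using True by (simp add: tcoeff_def)
    next
      case False
      have "?w (f \<iota> k) (g \<iota> i) = 0"
      proof (rule ccontr)
        assume "?w (f \<iota> k) (g \<iota> i) \<noteq> 0"
        then obtain j where "j \<le> M" "g \<iota> i = g \<iota> (k + j)"
          using hit[OF \<iota> k] by blast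
        then have "i = k + j" using uv by (simp add: g_def \<iota>_eq)
        then show False using False \<open>j \<le> M\<close> by simp
      qed
      moreover have "tcoeff M k i = 0"
        using False by (auto simp: tcoeff_def binomial_eq_0)
      ultimately show ?thesis by simp
    qed
    have "card (mod_image p (f \<iota> ` D \<iota>) (g \<iota> ` B \<iota>) ?w) = card (mod_image p (D \<iota>) (B \<iota>) (tcoeff M))"
      unfolding card_mod_image_reindex[OF inj] by (intro arg_cong[where f = card] mod_image_mod_cong) (simp add: w)
    also have "\<dots> = p ^ ?r \<alpha> \<beta> d"
      using card_mod_image_tcoeff[OF p mp np, of M d \<alpha> \<beta>] M unfolding D_def B_def \<iota>_eq
      by (simp add: M_def m_def n_def)
    finally show "card (mod_image p (f \<iota> ` D \<iota>) (g \<iota> ` B \<iota>) ?w) = p ^ (case \<iota> of (\<alpha>, \<beta>, d) \<Rightarrow> ?r \<alpha> \<beta> d)"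
      by (simp add: \<iota>_eq)
  qed
  also have "\<dots> = p ^ (\<Sum>(\<alpha>, \<beta>, d)\<in>I. ?r \<alpha> \<beta> d)"
    by (simp add: power_sum)
  also have "(\<Sum>(\<alpha>, \<beta>, d)\<in>I. ?r \<alpha> \<beta> d) = (\<Sum>\<alpha><u. \<Sum>\<beta><v. \<Sum>d<2 * p. ?r \<alpha> \<beta> d)"
    unfolding I_def by (simp only: sum.cartesian_product)
  finally show ?thesis .
qed

section \<open>Power series over \<open>\<int>/p\<close>\<close>

text \<open>Reduction from Z[[x]][[y]], with y as the outer variable. It is onto and respects the
  operations, so the ring axioms of \<open>Fp_xy p\<close> become identities between ordinary formal
  power series.\<close>

definition fps_mod :: "nat \<Rightarrow> int fps fps \<Rightarrow> nat \<Rightarrow> nat \<Rightarrow> int" where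
  "fps_mod p F = (\<lambda>i j. fps_nth (fps_nth F j) i mod int p)"

lemma residue_ring_cring: "prime p \<Longrightarrow> cring (residue_ring (int p))"
  using residues.cring[of "int p"] prime_gt_1_int[of "int p"] by (simp add: residues_def)

lemma finsum_residue_ring:
  assumes "prime p" "finite A" "f \<in> A \<rightarrow> {0..<int p}"
  shows "finsum (residue_ring (int p)) f A = (\<Sum>x\<in>A. f x) mod int p"
  using assms(2,3)
proof (induction A rule: finite_induct)
  case empty
  interpret cring "residue_ring (int p)" by (rule residue_ring_cring[OF assms(1)])
  show ?case by (simp only: finsum_empty) (simp add: residue_ring_def)
next
  case (insert x A)
  interpret cring "residue_ring (int p)" by (rule residue_ring_cring[OF assms(1)])
  have "f \<in> A \<rightarrow> carrier (residue_ring (int p))" "f x \<in> carrier (residue_ring (int p))"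
    using insert.prems by (auto simp: residue_ring_def)
  then have "finsum (residue_ring (int p)) f (insert x A)
      = (f x + finsum (residue_ring (int p)) f A) mod int p"
    using insert.hyps by (subst finsum_insert) (auto simp: residue_ring_def)
  then show ?case
    using insert by (simp add: mod_simps)
qed

lemma carrier_Fp_xy: "carrier (Fp_xy p) = {f. \<forall>i j. f i j \<in> {0..<int p}}"
  by (auto simp: fps2_def residue_ring_def)

lemma zero_Fp_xy: "\<zero>\<^bsub>Fp_xy p\<^esub> = (\<lambda>i j. 0)"
  by (simp add: fps2_def residue_ring_def)

lemma add_Fp_xy: "f \<oplus>\<^bsub>Fp_xy p\<^esub> g = (\<lambda>i j. (f i j + g i j) mod int p)"
  by (simp add: fps2_def residue_ring_def)

lemma mult_Fp_xy:
  assumes "prime p"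
  shows "f \<otimes>\<^bsub>Fp_xy p\<^esub> g = (\<lambda>i j. (\<Sum>k\<le>i. \<Sum>l\<le>j. f k l * g (i - k) (j - l)) mod int p)"
proof (intro ext)
  fix i j
  have p0: "p > 0" using assms by (rule prime_gt_0_nat)
  have "(f \<otimes>\<^bsub>Fp_xy p\<^esub> g) i j = finsum (residue_ring (int p))
      (\<lambda>k. finsum (residue_ring (int p)) (\<lambda>l. f k l * g (i - k) (j - l) mod int p) {..j}) {..i}"
    by (simp add: fps2_def residue_ring_def)
  also have "\<dots> = (\<Sum>k\<le>i. (\<Sum>l\<le>j. f k l * g (i - k) (j - l) mod int p) mod int p) mod int p"
    using p0 by (subst (1 2) finsum_residue_ring[OF assms]) (auto intro!: Pi_I simp: finsum_residue_ring[OF assms])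
  also have "\<dots> = (\<Sum>k\<le>i. \<Sum>l\<le>j. f k l * g (i - k) (j - l)) mod int p"
    by (simp add: mod_sum_eq)
  finally show "(f \<otimes>\<^bsub>Fp_xy p\<^esub> g) i j = (\<Sum>k\<le>i. \<Sum>l\<le>j. f k l * g (i - k) (j - l)) mod int p" .
qed

lemma fps_mod_closed: "prime p \<Longrightarrow> fps_mod p F \<in> carrier (Fp_xy p)"
  using prime_gt_0_nat[of p] by (simp add: carrier_Fp_xy fps_mod_def)

lemma fps_mod_surj:
  assumes "f \<in> carrier (Fp_xy p)"
  obtains F where "f = fps_mod p F"
proof
  show "f = fps_mod p (Abs_fps (\<lambda>j. Abs_fps (\<lambda>i. f i j)))"
    using assms by (auto simp: fps_mod_def carrier_Fp_xy fun_eq_iff)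
qed

lemma fps_mod_add: "fps_mod p F \<oplus>\<^bsub>Fp_xy p\<^esub> fps_mod p G = fps_mod p (F + G)"
  by (simp add: add_Fp_xy fps_mod_def mod_simps)

lemma fps_mod_mult:
  assumes "prime p"
  shows "fps_mod p F \<otimes>\<^bsub>Fp_xy p\<^esub> fps_mod p G = fps_mod p (F * G)"
proof (intro ext)
  fix i j
  have "(fps_mod p F \<otimes>\<^bsub>Fp_xy p\<^esub> fps_mod p G) i j
      = (\<Sum>k\<le>i. \<Sum>l\<le>j. fps_nth (fps_nth F l) k * fps_nth (fps_nth G (j - l)) (i - k)) mod int p"
    unfolding mult_Fp_xy[OF assms] cong_def[symmetric]
    by (intro cong_sum cong_mult) (simp_all add: fps_mod_def cong_def)
  also have "\<dots> = fps_mod p (F * G) i j"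
    unfolding fps_mod_def fps_mult_nth fps_sum_nth atLeast0AtMost by (subst sum.swap) simp
  finally show "(fps_mod p F \<otimes>\<^bsub>Fp_xy p\<^esub> fps_mod p G) i j = fps_mod p (F * G) i j" .
qed

lemma fps_mod_one: "prime p \<Longrightarrow> \<one>\<^bsub>Fp_xy p\<^esub> = fps_mod p 1"
  using prime_gt_1_nat[of p] by (auto simp: fps2_def residue_ring_def fps_mod_def fps_one_nth fun_eq_iff)

lemma fps_mod_zero: "\<zero>\<^bsub>Fp_xy p\<^esub> = fps_mod p 0"
  by (simp add: zero_Fp_xy fps_mod_def)

lemma cring_Fp_xy:
  assumes p: "prime p"
  shows "cring (Fp_xy p)"
proof (intro cringI abelian_groupI comm_monoidI)
  note simps = fps_mod_add fps_mod_mult[OF p] fps_mod_one[OF p] fps_mod_zero fps_mod_closed[OF p]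
  fix f assume "f \<in> carrier (Fp_xy p)"
  then obtain F where F: "f = fps_mod p F" by (rule fps_mod_surj)
  show "\<one>\<^bsub>Fp_xy p\<^esub> \<otimes>\<^bsub>Fp_xy p\<^esub> f = f" "\<zero>\<^bsub>Fp_xy p\<^esub> \<oplus>\<^bsub>Fp_xy p\<^esub> f = f"
    unfolding F simps by simp_all
  show "\<exists>g\<in>carrier (Fp_xy p). g \<oplus>\<^bsub>Fp_xy p\<^esub> f = \<zero>\<^bsub>Fp_xy p\<^esub>"
    by (rule bexI[of _ "fps_mod p (- F)"]) (simp_all only: F simps, simp)
  fix g assume "g \<in> carrier (Fp_xy p)"
  then obtain G where G: "g = fps_mod p G" by (rule fps_mod_surj)
  show "f \<oplus>\<^bsub>Fp_xy p\<^esub> g \<in> carrier (Fp_xy p)" "f \<otimes>\<^bsub>Fp_xy p\<^esub> g \<in> carrier (Fp_xy p)"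
    unfolding F G simps by (rule fps_mod_closed[OF p])+
  show "f \<oplus>\<^bsub>Fp_xy p\<^esub> g = g \<oplus>\<^bsub>Fp_xy p\<^esub> f" "f \<otimes>\<^bsub>Fp_xy p\<^esub> g = g \<otimes>\<^bsub>Fp_xy p\<^esub> f"
    unfolding F G simps by (simp_all add: ac_simps)
  fix h assume "h \<in> carrier (Fp_xy p)"
  then obtain H where H: "h = fps_mod p H" by (rule fps_mod_surj)
  show "f \<oplus>\<^bsub>Fp_xy p\<^esub> g \<oplus>\<^bsub>Fp_xy p\<^esub> h = f \<oplus>\<^bsub>Fp_xy p\<^esub> (g \<oplus>\<^bsub>Fp_xy p\<^esub> h)"
    "f \<otimes>\<^bsub>Fp_xy p\<^esub> g \<otimes>\<^bsub>Fp_xy p\<^esub> h = f \<otimes>\<^bsub>Fp_xy p\<^esub> (g \<otimes>\<^bsub>Fp_xy p\<^esub> h)"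
    "(f \<oplus>\<^bsub>Fp_xy p\<^esub> g) \<otimes>\<^bsub>Fp_xy p\<^esub> h = f \<otimes>\<^bsub>Fp_xy p\<^esub> h \<oplus>\<^bsub>Fp_xy p\<^esub> g \<otimes>\<^bsub>Fp_xy p\<^esub> h"
    unfolding F G H simps by (simp_all add: algebra_simps)
next
  show "\<zero>\<^bsub>Fp_xy p\<^esub> \<in> carrier (Fp_xy p)" "\<one>\<^bsub>Fp_xy p\<^esub> \<in> carrier (Fp_xy p)"
    by (simp_all add: fps_mod_one[OF p] fps_mod_zero fps_mod_closed[OF p])
qed

lemma minus_Fp_xy:
  assumes p: "prime p" and "f \<in> carrier (Fp_xy p)" "g \<in> carrier (Fp_xy p)"
  shows "f \<ominus>\<^bsub>Fp_xy p\<^esub> g = (\<lambda>i j. (f i j - g i j) mod int p)"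
proof -
  interpret cring "Fp_xy p" by (rule cring_Fp_xy[OF p])
  obtain F G where FG: "f = fps_mod p F" "g = fps_mod p G"
    using assms(2,3) by (metis fps_mod_surj)
  have "f = fps_mod p (F - G) \<oplus>\<^bsub>Fp_xy p\<^esub> g"
    unfolding FG fps_mod_add by simp
  then have "f \<ominus>\<^bsub>Fp_xy p\<^esub> g = fps_mod p (F - G)"
    using assms(2,3) fps_mod_closed[OF p, of "F - G"] by (metis a_minus_def a_assoc r_neg r_zero a_inv_closed)
  then show ?thesis
    by (simp add: FG fps_mod_def mod_simps)
qed

lemma reduce_mod_conv_fps_mod:
  "reduce_mod p P = fps_mod p (Abs_fps (\<lambda>j. Abs_fps (\<lambda>i. Polynomial.coeff (Polynomial.coeff P j) i)))"
  by (simp add: reduce_mod_def fps_mod_def)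

lemma reduce_mod_closed: "prime p \<Longrightarrow> reduce_mod p P \<in> carrier (Fp_xy p)"
  by (simp add: reduce_mod_conv_fps_mod fps_mod_closed)

lemma reduce_mod_mult:
  assumes "prime p"
  shows "reduce_mod p P \<otimes>\<^bsub>Fp_xy p\<^esub> reduce_mod p Q = reduce_mod p (P * Q)"
proof -
  have "Abs_fps (\<lambda>j. Abs_fps (\<lambda>i. Polynomial.coeff (Polynomial.coeff P j) i))
      * Abs_fps (\<lambda>j. Abs_fps (\<lambda>i. Polynomial.coeff (Polynomial.coeff Q j) i))
    = Abs_fps (\<lambda>j. Abs_fps (\<lambda>i. Polynomial.coeff (Polynomial.coeff (P * Q) j) i))"
    by (intro fps_ext) (simp add: fps_mult_nth fps_sum_nth coeff_mult coeff_sum atLeast0AtMost)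
  then show ?thesis
    by (simp add: reduce_mod_conv_fps_mod fps_mod_mult[OF assms])
qed

lemma reduce_mod_power:
  assumes "prime p"
  shows "reduce_mod p P [^]\<^bsub>Fp_xy p\<^esub> (n :: nat) = reduce_mod p (P ^ n)"
proof -
  interpret cring "Fp_xy p" by (rule cring_Fp_xy[OF assms])
  have "reduce_mod p 1 = \<one>\<^bsub>Fp_xy p\<^esub>"
    using prime_gt_1_nat[OF assms]
    by (auto simp: fps_mod_one[OF assms] reduce_mod_def fps_mod_def fun_eq_iff coeff_1)
  then show ?thesis
    by (induction n) (simp_all add: reduce_mod_mult[OF assms] mult.commute)
qed

lemma monomial_conv_monom:
  "[:[:0, 1:]:] ^ i * [:0, 1:] ^ j = (Polynomial.monom (Polynomial.monom 1 i) j :: int poly poly)"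
proof -
  have "[:[:0, 1:]:] ^ i = (Polynomial.monom (Polynomial.monom 1 i) 0 :: int poly poly)"
    by (induction i) (simp_all add: Polynomial.monom_Suc Polynomial.monom_0 Polynomial.mult_monom one_pCons[symmetric])
  moreover have "[:0, 1:] ^ j = (Polynomial.monom 1 j :: int poly poly)"
    by (simp add: Polynomial.monom_altdef)
  ultimately show ?thesis by (simp add: Polynomial.mult_monom)
qed

lemma fps2_X_power:
  assumes "prime p"
  shows "fps2_X (residue_ring (int p)) [^]\<^bsub>Fp_xy p\<^esub> (n :: nat) = (\<lambda>i j. if i = n \<and> j = 0 then 1 else 0)"
proof -
  have "fps2_X (residue_ring (int p)) = reduce_mod p ([:[:0, 1:]:] ^ 1 * [:0, 1:] ^ 0)"
    using prime_gt_1_nat[OF assms] unfolding monomial_conv_monom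
    by (auto simp: fps2_X_def residue_ring_def reduce_mod_def fun_eq_iff)
  moreover have "reduce_mod p ([:[:0, 1:]:] ^ n * [:0, 1:] ^ 0) = (\<lambda>i j. if i = n \<and> j = 0 then 1 else 0)"
    using prime_gt_1_nat[OF assms] unfolding monomial_conv_monom
    by (auto simp: reduce_mod_def fun_eq_iff)
  ultimately show ?thesis
    by (simp add: reduce_mod_power[OF assms])
qed

lemma fps2_Y_power:
  assumes "prime p"
  shows "fps2_Y (residue_ring (int p)) [^]\<^bsub>Fp_xy p\<^esub> (n :: nat) = (\<lambda>i j. if i = 0 \<and> j = n then 1 else 0)"
proof -
  have "fps2_Y (residue_ring (int p)) = reduce_mod p ([:[:0, 1:]:] ^ 0 * [:0, 1:] ^ 1)"
    using prime_gt_1_nat[OF assms] unfolding monomial_conv_monom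
    by (auto simp: fps2_Y_def residue_ring_def reduce_mod_def fun_eq_iff)
  moreover have "reduce_mod p ([:[:0, 1:]:] ^ 0 * [:0, 1:] ^ n) = (\<lambda>i j. if i = 0 \<and> j = n then 1 else 0)"
    using prime_gt_1_nat[OF assms] unfolding monomial_conv_monom
    by (auto simp: reduce_mod_def fun_eq_iff)
  ultimately show ?thesis
    by (simp add: reduce_mod_power[OF assms])
qed

lemma coeff_poly_g_power:
  "Polynomial.coeff (Polynomial.coeff (poly_g a b c u v ^ N) j) i = gcoeff a b c u v N i j"
proof -
  let ?x = "[:[:0, 1:]:] :: int poly poly" and ?y = "[:0, 1:] :: int poly poly"
  have "poly_g a b c u v ^ N = ?x ^ (a * N) * ?y ^ (b * N) * (?x ^ u + ?y ^ v) ^ (c * N)"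
    by (simp add: poly_g_def Let_def power_mult_distrib power_mult)
  also have "\<dots> = (\<Sum>k\<le>c * N. of_nat ((c * N) choose k) * (?x ^ (a * N + u * k) * ?y ^ (b * N + v * (c * N - k))))"
    unfolding binomial_ring sum_distrib_left
    by (intro sum.cong refl) (simp add: power_add power_mult[symmetric] mult_ac)
  also have "\<dots> = (\<Sum>k\<le>c * N. of_nat ((c * N) choose k) * Polynomial.monom (Polynomial.monom 1 (a * N + u * k)) (b * N + v * (c * N - k)))"
    by (simp only: monomial_conv_monom)
  finally have "poly_g a b c u v ^ N
      = (\<Sum>k\<le>c * N. of_nat ((c * N) choose k) * Polynomial.monom (Polynomial.monom 1 (a * N + u * k)) (b * N + v * (c * N - k)))" .
  then show ?thesis
    unfolding gcoeff_def by (simp add: coeff_sum of_nat_poly) (intro sum.cong, auto)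
qed

section \<open>Lengths\<close>

abbreviation const_series :: "int \<Rightarrow> nat \<Rightarrow> nat \<Rightarrow> int" where
  "const_series c \<equiv> \<lambda>i j. if i = 0 \<and> j = 0 then c else 0"

abbreviation x_power :: "nat \<Rightarrow> nat \<Rightarrow> nat \<Rightarrow> int" where
  "x_power n \<equiv> \<lambda>i j. if i = n \<and> j = 0 then 1 else 0"

abbreviation y_power :: "nat \<Rightarrow> nat \<Rightarrow> nat \<Rightarrow> int" where
  "y_power n \<equiv> \<lambda>i j. if i = 0 \<and> j = n then 1 else 0"

lemma monomial_mult_Fp_xy:
  assumes p: "prime p" and f: "f \<in> carrier (Fp_xy p)"
  shows "(\<lambda>i j. if i = m \<and> j = n then c else 0) \<otimes>\<^bsub>Fp_xy p\<^esub> f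
    = (\<lambda>i j. if m \<le> i \<and> n \<le> j then c * f (i - m) (j - n) mod int p else 0)"
proof (intro ext)
  fix i j
  have "(\<Sum>k\<le>i. \<Sum>l\<le>j. (if k = m \<and> l = n then c else 0) * f (i - k) (j - l))
      = (\<Sum>k\<le>i. if k = m then (\<Sum>l\<le>j. if l = n then c * f (i - m) (j - n) else 0) else 0)"
    by (intro sum.cong refl) (auto intro!: sum.cong simp del: sum.delta sum.delta')
  also have "\<dots> = (if m \<le> i \<and> n \<le> j then c * f (i - m) (j - n) else 0)"
    by simp
  finally show "((\<lambda>i j. if i = m \<and> j = n then c else 0) \<otimes>\<^bsub>Fp_xy p\<^esub> f) i j
    = (if m \<le> i \<and> n \<le> j then c * f (i - m) (j - n) mod int p else 0)"
    by (simp add: mult_Fp_xy[OF p])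
qed

lemma carrier_mod: "f \<in> carrier (Fp_xy p) \<Longrightarrow> f i j mod int p = f i j"
  by (simp add: carrier_Fp_xy)

lemma power_mult_Fp_xy:
  assumes "prime p" "f \<in> carrier (Fp_xy p)"
  shows "x_power n \<otimes>\<^bsub>Fp_xy p\<^esub> f = (\<lambda>i j. if n \<le> i then f (i - n) j else 0)"
    and "y_power n \<otimes>\<^bsub>Fp_xy p\<^esub> f = (\<lambda>i j. if n \<le> j then f i (j - n) else 0)"
  by (auto simp: monomial_mult_Fp_xy[OF assms] carrier_mod[OF assms(2)] fun_eq_iff)

lemma power_closed_Fp_xy:
  assumes "prime p"
  shows "x_power n \<in> carrier (Fp_xy p)" "y_power n \<in> carrier (Fp_xy p)"
  using prime_gt_1_nat[OF assms] by (auto simp: carrier_Fp_xy)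

lemma const_series_closed: "c \<in> {0..<int p} \<Longrightarrow> const_series c \<in> carrier (Fp_xy p)"
  by (auto simp: carrier_Fp_xy)

text \<open>Monomials divisible by x^n are collected in \<open>f1\<close>, the others, which are
  then divisible by y^n, in \<open>f2\<close>. Used with n = q for the Frobenius ideal and with n =
  1 for series without constant term.\<close>

lemma split_Fp_xy:
  assumes p: "prime p" and f: "f \<in> carrier (Fp_xy p)" and vanish: "\<And>i j. i < n \<Longrightarrow> j < n \<Longrightarrow> f i j = 0"
  obtains f1 f2 where "f1 \<in> carrier (Fp_xy p)" "f2 \<in> carrier (Fp_xy p)"
    "f = x_power n \<otimes>\<^bsub>Fp_xy p\<^esub> f1 \<oplus>\<^bsub>Fp_xy p\<^esub> y_power n \<otimes>\<^bsub>Fp_xy p\<^esub> f2"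
proof
  let ?f1 = "\<lambda>i j. f (i + n) j" and ?f2 = "\<lambda>i j. if i < n then f i (j + n) else 0"
  show closed: "?f1 \<in> carrier (Fp_xy p)" "?f2 \<in> carrier (Fp_xy p)"
    using f prime_gt_0_nat[OF p] by (auto simp: carrier_Fp_xy)
  show "f = x_power n \<otimes>\<^bsub>Fp_xy p\<^esub> ?f1 \<oplus>\<^bsub>Fp_xy p\<^esub> y_power n \<otimes>\<^bsub>Fp_xy p\<^esub> ?f2"
    unfolding power_mult_Fp_xy(1)[OF p closed(1)] power_mult_Fp_xy(2)[OF p closed(2)] add_Fp_xy
    using vanish carrier_mod[OF f] by (auto simp: fun_eq_iff not_less)
qed

lemma uminus_Fp_xy:
  assumes p: "prime p" and f: "f \<in> carrier (Fp_xy p)"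
  shows "\<ominus>\<^bsub>Fp_xy p\<^esub> f = (\<lambda>i j. - f i j mod int p)"
proof -
  interpret cring "Fp_xy p" by (rule cring_Fp_xy[OF p])
  have "\<ominus>\<^bsub>Fp_xy p\<^esub> f = \<zero>\<^bsub>Fp_xy p\<^esub> \<ominus>\<^bsub>Fp_xy p\<^esub> f"
    using f by (simp add: a_minus_def)
  also have "\<dots> = (\<lambda>i j. - f i j mod int p)"
    using f zero_closed by (simp add: minus_Fp_xy[OF p] zero_Fp_xy)
  finally show ?thesis .
qed

text \<open>The series without coefficients in the box form an ideal that contains both generators,
  and \<open>split_Fp_xy\<close> writes each of them in terms of the generators. Membership thereby
  becomes a condition on finitely many coefficients.\<close>

lemma frobenius_ideal_eq:
  assumes p: "prime p"
  shows "frobenius_ideal p e = {f \<in> carrier (Fp_xy p). \<forall>i j. i < p ^ e \<longrightarrow> j < p ^ e \<longrightarrow> f i j = 0}"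
    (is "_ = ?I")
    and "ideal (frobenius_ideal p e) (Fp_xy p)"
proof -
  interpret cring "Fp_xy p" by (rule cring_Fp_xy[OF p])
  let ?q = "p ^ e"
  have def: "frobenius_ideal p e = Idl\<^bsub>Fp_xy p\<^esub> {x_power ?q, y_power ?q}"
    by (simp only: frobenius_ideal_def fps2_X_power[OF p] fps2_Y_power[OF p])
  have closed: "{x_power ?q, y_power ?q} \<subseteq> carrier (Fp_xy p)"
    using power_closed_Fp_xy[OF p] by auto
  show id: "ideal (frobenius_ideal p e) (Fp_xy p)"
    unfolding def by (rule genideal_ideal[OF closed])
  interpret I: ideal "frobenius_ideal p e" "Fp_xy p" by (rule id)
  have vanish: "(f \<otimes>\<^bsub>Fp_xy p\<^esub> g) i j = 0" if "f \<in> ?I" "i < ?q" "j < ?q" for f g i j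
    using that by (simp add: mult_Fp_xy[OF p])
  have "subgroup ?I (add_monoid (Fp_xy p))"
  proof (rule group.subgroupI[OF a_group])
    show "?I \<noteq> {}" using zero_closed by (auto simp: zero_Fp_xy)
    fix f g assume f: "f \<in> ?I"
    then show "inv\<^bsub>add_monoid (Fp_xy p)\<^esub> f \<in> ?I"
      using a_inv_closed[of f] uminus_Fp_xy[OF p, of f] by (simp add: a_inv_def)
    assume "g \<in> ?I"
    then show "f \<otimes>\<^bsub>add_monoid (Fp_xy p)\<^esub> g \<in> ?I"
      using f a_closed[of f g] by (simp add: add_Fp_xy)
  qed auto
  then have "ideal ?I (Fp_xy p)"
    using vanish m_comm by (intro idealI[OF local.ring_axioms]) auto
  then have "frobenius_ideal p e \<subseteq> ?I"
    unfolding def using closed by (intro genideal_minimal) auto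
  moreover have "?I \<subseteq> frobenius_ideal p e"
  proof
    fix f assume f: "f \<in> ?I"
    then obtain f1 f2 where "f1 \<in> carrier (Fp_xy p)" "f2 \<in> carrier (Fp_xy p)"
      and "f = x_power ?q \<otimes>\<^bsub>Fp_xy p\<^esub> f1 \<oplus>\<^bsub>Fp_xy p\<^esub> y_power ?q \<otimes>\<^bsub>Fp_xy p\<^esub> f2"
      using split_Fp_xy[OF p, of f ?q] by auto
    moreover have "x_power ?q \<in> frobenius_ideal p e" "y_power ?q \<in> frobenius_ideal p e"
      unfolding def using genideal_self[OF closed] by auto
    ultimately show "f \<in> frobenius_ideal p e"
      using I.I_r_closed I.a_closed by simp
  qed
  ultimately show "frobenius_ideal p e = ?I" by blast
qed

section \<open>Colon ideals, quotient modules and finite length\<close>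

lemma (in cring) colon_ideal_ideal:
  assumes "ideal I R" "g \<in> carrier R"
  shows "ideal (colon_ideal R I g) R"
proof -
  interpret I: ideal I R by fact
  have "subgroup (colon_ideal R I g) (add_monoid R)"
  proof (rule group.subgroupI[OF a_group])
    show "colon_ideal R I g \<noteq> {}"
      using assms(2) I.zero_closed by (auto simp: colon_ideal_def intro!: exI[of _ \<zero>])
    fix r s assume r: "r \<in> colon_ideal R I g"
    then have "\<ominus> r \<in> colon_ideal R I g"
      using assms(2) by (simp add: colon_ideal_def l_minus)
    then show "inv\<^bsub>add_monoid R\<^esub> r \<in> colon_ideal R I g"
      by (simp add: a_inv_def)
    assume "s \<in> colon_ideal R I g"
    then show "r \<otimes>\<^bsub>add_monoid R\<^esub> s \<in> colon_ideal R I g"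
      using r assms(2) by (simp add: colon_ideal_def l_distr)
  qed (auto simp: colon_ideal_def)
  then show ?thesis
  proof (rule idealI[OF local.ring_axioms])
    fix r s assume "r \<in> colon_ideal R I g" "s \<in> carrier R"
    then show "s \<otimes> r \<in> colon_ideal R I g"
      using assms(2) I.I_l_closed by (simp add: colon_ideal_def m_assoc)
    then show "r \<otimes> s \<in> colon_ideal R I g"
      using \<open>r \<in> _\<close> \<open>s \<in> _\<close> by (simp add: m_comm colon_ideal_def)
  qed
qed

lemma (in cring) module_quotient_module:
  assumes "ideal J R"
  shows "module R (quotient_module R J)"
proof (rule moduleI)
  interpret J: ideal J R by fact
  interpret Q: cring "R Quot J" by (rule J.quotient_is_cring[OF is_cring])
  interpret h: ring_hom_cring R "R Quot J" "(+>) J" by (rule J.rcos_ring_hom_cring[OF is_cring])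
  note simps = quotient_module_def
  show "cring R" by (rule is_cring)
  show "abelian_group (quotient_module R J)"
  proof (rule abelian_groupI)
    fix x assume "x \<in> carrier (quotient_module R J)"
    then have "x \<in> carrier (R Quot J)" by (simp add: simps)
    then show "\<exists>y\<in>carrier (quotient_module R J). y \<oplus>\<^bsub>quotient_module R J\<^esub> x = \<zero>\<^bsub>quotient_module R J\<^esub>"
      using Q.l_neg by (intro bexI[of _ "\<ominus>\<^bsub>R Quot J\<^esub> x"]) (simp_all add: simps)
  qed (simp_all add: simps Q.a_ac)
  fix a b x y
  assume "a \<in> carrier R" "x \<in> carrier (quotient_module R J)"
  then have ax: "a \<in> carrier R" "x \<in> carrier (R Quot J)" by (simp_all add: simps)
  show "a \<odot>\<^bsub>quotient_module R J\<^esub> x \<in> carrier (quotient_module R J)"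
    using ax by (simp add: simps)
  assume "b \<in> carrier R"
  then show "(a \<oplus> b) \<odot>\<^bsub>quotient_module R J\<^esub> x
      = a \<odot>\<^bsub>quotient_module R J\<^esub> x \<oplus>\<^bsub>quotient_module R J\<^esub> b \<odot>\<^bsub>quotient_module R J\<^esub> x"
    "a \<otimes> b \<odot>\<^bsub>quotient_module R J\<^esub> x = a \<odot>\<^bsub>quotient_module R J\<^esub> (b \<odot>\<^bsub>quotient_module R J\<^esub> x)"
    using ax by (simp_all add: simps Q.l_distr Q.m_assoc)
next
  interpret J: ideal J R by fact
  interpret Q: cring "R Quot J" by (rule J.quotient_is_cring[OF is_cring])
  interpret h: ring_hom_cring R "R Quot J" "(+>) J" by (rule J.rcos_ring_hom_cring[OF is_cring])
  fix a x y
  assume "a \<in> carrier R" "x \<in> carrier (quotient_module R J)" "y \<in> carrier (quotient_module R J)"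
  then show "a \<odot>\<^bsub>quotient_module R J\<^esub> (x \<oplus>\<^bsub>quotient_module R J\<^esub> y)
      = a \<odot>\<^bsub>quotient_module R J\<^esub> x \<oplus>\<^bsub>quotient_module R J\<^esub> a \<odot>\<^bsub>quotient_module R J\<^esub> y"
    by (simp add: quotient_module_def Q.r_distr)
next
  interpret J: ideal J R by fact
  interpret Q: cring "R Quot J" by (rule J.quotient_is_cring[OF is_cring])
  interpret h: ring_hom_cring R "R Quot J" "(+>) J" by (rule J.rcos_ring_hom_cring[OF is_cring])
  fix x assume "x \<in> carrier (quotient_module R J)"
  then show "\<one> \<odot>\<^bsub>quotient_module R J\<^esub> x = x"
    using h.hom_one by (simp add: quotient_module_def)
qed

text \<open>A maximal monomial multiple of an element outside \<open>N\<close> that is still outside \<open>N\<close>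
  spans the extension.\<close>

lemma submodule_extend:
  assumes p: "prime p" and M: "module (Fp_xy p) M" and fin: "finite (carrier M)"
    and nilp: "\<And>m. m \<in> carrier M \<Longrightarrow> x_power n \<odot>\<^bsub>M\<^esub> m = \<zero>\<^bsub>M\<^esub>"
      "\<And>m. m \<in> carrier M \<Longrightarrow> y_power n \<odot>\<^bsub>M\<^esub> m = \<zero>\<^bsub>M\<^esub>"
    and N: "submodule N (Fp_xy p) M" "N \<noteq> carrier M"
  obtains N' where "submodule N' (Fp_xy p) M" "N \<subset> N'" "card N' = p * card N"
proof -
  interpret M: module "Fp_xy p" M by (rule M)
  interpret N: submodule N "Fp_xy p" M by (rule N)
  note NE = M.submoduleE[OF N(1)]
  have N0: "\<zero>\<^bsub>M\<^esub> \<in> N"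
    using N.one_closed by simp
  have sub: "N \<subseteq> carrier M" by (rule NE(1))
  have xy: "x_power i \<in> carrier (Fp_xy p)" "y_power i \<in> carrier (Fp_xy p)" for i
    by (rule power_closed_Fp_xy[OF p])+
  have pow0: "x_power 0 = \<one>\<^bsub>Fp_xy p\<^esub>" "y_power 0 = \<one>\<^bsub>Fp_xy p\<^esub>"
    by (auto simp: fps2_def residue_ring_def fun_eq_iff)
  have pow_Suc: "x_power (Suc i) = x_power 1 \<otimes>\<^bsub>Fp_xy p\<^esub> x_power i"
    "y_power (Suc i) = y_power 1 \<otimes>\<^bsub>Fp_xy p\<^esub> y_power i" for i
    unfolding power_mult_Fp_xy(1)[OF p xy(1)] power_mult_Fp_xy(2)[OF p xy(2)] by (auto simp: fun_eq_iff)
  have "\<exists>z\<in>carrier M. z \<notin> N \<and> x_power 1 \<odot>\<^bsub>M\<^esub> z \<in> N \<and> y_power 1 \<odot>\<^bsub>M\<^esub> z \<in> N"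
  proof -
    obtain z0 where z0: "z0 \<in> carrier M" "z0 \<notin> N" using N sub by blast
    define i where "i = (LEAST i. x_power i \<odot>\<^bsub>M\<^esub> z0 \<in> N)"
    have i: "x_power i \<odot>\<^bsub>M\<^esub> z0 \<in> N"
      unfolding i_def by (rule LeastI[of _ n]) (simp only: nilp(1)[OF z0(1)] N0)
    have "i \<noteq> 0"
    proof
      assume "i = 0"
      then have "\<one>\<^bsub>Fp_xy p\<^esub> \<odot>\<^bsub>M\<^esub> z0 \<in> N" using i by (simp only: pow0)
      then show False using z0 by simp
    qed
    then obtain i' where i': "i = Suc i'" by (cases i) auto
    define z1 where "z1 = x_power i' \<odot>\<^bsub>M\<^esub> z0"
    have z1: "z1 \<in> carrier M" "z1 \<notin> N" "x_power 1 \<odot>\<^bsub>M\<^esub> z1 \<in> N"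
    proof -
      show "z1 \<in> carrier M" unfolding z1_def by (rule M.smult_closed[OF xy(1) z0(1)])
      show "z1 \<notin> N" unfolding z1_def using not_less_Least[of i' "\<lambda>i. x_power i \<odot>\<^bsub>M\<^esub> z0 \<in> N"] i' by (simp add: i_def)
      show "x_power 1 \<odot>\<^bsub>M\<^esub> z1 \<in> N"
        unfolding z1_def M.smult_assoc1[OF xy(1) xy(1) z0(1), symmetric] pow_Suc(1)[symmetric] i'[symmetric] by (rule i)
    qed
    \<comment> \<open>Passing to multiples by powers of y keeps x z in N, as x and y commute and N
      is a submodule.\<close>
    define j where "j = (LEAST j. y_power j \<odot>\<^bsub>M\<^esub> z1 \<in> N)"
    have j: "y_power j \<odot>\<^bsub>M\<^esub> z1 \<in> N"
      unfolding j_def by (rule LeastI[of _ n]) (simp only: nilp(2)[OF z1(1)] N0)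
    have "j \<noteq> 0"
    proof
      assume "j = 0"
      then have "\<one>\<^bsub>Fp_xy p\<^esub> \<odot>\<^bsub>M\<^esub> z1 \<in> N" using j by (simp only: pow0)
      then show False using z1 by simp
    qed
    then obtain j' where j': "j = Suc j'" by (cases j) auto
    define z where "z = y_power j' \<odot>\<^bsub>M\<^esub> z1"
    have "z \<in> carrier M" unfolding z_def by (rule M.smult_closed[OF xy(2) z1(1)])
    moreover have "z \<notin> N"
      unfolding z_def using not_less_Least[of j' "\<lambda>j. y_power j \<odot>\<^bsub>M\<^esub> z1 \<in> N"] j' by (simp add: j_def)
    moreover have "y_power 1 \<odot>\<^bsub>M\<^esub> z \<in> N"
      unfolding z_def M.smult_assoc1[OF xy(2) xy(2) z1(1), symmetric] pow_Suc(2)[symmetric] j'[symmetric] by (rule j)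
    moreover have "x_power 1 \<odot>\<^bsub>M\<^esub> z \<in> N"
      unfolding z_def M.smult_assoc1[OF xy z1(1), symmetric] M.R.m_comm[OF xy]
        M.smult_assoc1[OF xy(2,1) z1(1)] by (rule NE(4)[OF xy(2) z1(3)])
    ultimately show ?thesis by blast
  qed
  then obtain z where z: "z \<in> carrier M" "z \<notin> N" "x_power 1 \<odot>\<^bsub>M\<^esub> z \<in> N" "y_power 1 \<odot>\<^bsub>M\<^esub> z \<in> N"
    by blast
  define K where "K = {0..<int p}"
  have K: "const_series c \<in> carrier (Fp_xy p)" if "c \<in> K" for c
    using that const_series_closed by (simp add: K_def)
  define \<phi> where "\<phi> = (\<lambda>(m, c). m \<oplus>\<^bsub>M\<^esub> const_series c \<odot>\<^bsub>M\<^esub> z)"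
  define N' where "N' = \<phi> ` (N \<times> K)"
  have N'I: "m \<oplus>\<^bsub>M\<^esub> const_series c \<odot>\<^bsub>M\<^esub> z \<in> N'" if "m \<in> N" "c \<in> K" for m c
    unfolding N'_def using that by (auto simp: \<phi>_def intro!: image_eqI[of _ \<phi> "(m, c)"])
  have N'E: "\<exists>m\<in>N. \<exists>c\<in>K. w = m \<oplus>\<^bsub>M\<^esub> const_series c \<odot>\<^bsub>M\<^esub> z" if "w \<in> N'" for w
    using that by (auto simp: N'_def \<phi>_def)
  have cz: "const_series c \<odot>\<^bsub>M\<^esub> z \<in> carrier M" if "c \<in> K" for c
    using K[OF that] z(1) by (rule M.smult_closed)
  have const_mod: "c mod int p \<in> K" for c
    using prime_gt_0_nat[OF p] by (simp add: K_def)
  have subN': "N' \<subseteq> carrier M"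
    using N'E sub cz M.a_closed by blast
  have add: "w \<oplus>\<^bsub>M\<^esub> w' \<in> N'" if ww: "w \<in> N'" "w' \<in> N'" for w w'
  proof -
    obtain m c where w1: "m \<in> N" "c \<in> K" "w = m \<oplus>\<^bsub>M\<^esub> const_series c \<odot>\<^bsub>M\<^esub> z"
      using N'E[OF ww(1)] by blast
    obtain m' c' where w2: "m' \<in> N" "c' \<in> K" "w' = m' \<oplus>\<^bsub>M\<^esub> const_series c' \<odot>\<^bsub>M\<^esub> z"
      using N'E[OF ww(2)] by blast
    note w = w1 w2
    have "const_series ((c + c') mod int p) = const_series c \<oplus>\<^bsub>Fp_xy p\<^esub> const_series c'"
      by (auto simp: add_Fp_xy fun_eq_iff)
    then have "const_series ((c + c') mod int p) \<odot>\<^bsub>M\<^esub> z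
        = const_series c \<odot>\<^bsub>M\<^esub> z \<oplus>\<^bsub>M\<^esub> const_series c' \<odot>\<^bsub>M\<^esub> z"
      using M.smult_l_distr[OF K[OF w(2)] K[OF w(5)] z(1)] by simp
    then have "w \<oplus>\<^bsub>M\<^esub> w' = (m \<oplus>\<^bsub>M\<^esub> m') \<oplus>\<^bsub>M\<^esub> const_series ((c + c') mod int p) \<odot>\<^bsub>M\<^esub> z"
      unfolding w using cz[OF w(2)] cz[OF w(5)] w(1,4) sub by (simp add: M.M.a_ac subset_iff)
    then show ?thesis
      using N'I[OF NE(5)[OF w(1,4)] const_mod] by simp
  qed
  have N_N': "N \<subseteq> N'"
  proof
    fix m assume m: "m \<in> N"
    have "const_series (0 mod int p) = \<zero>\<^bsub>Fp_xy p\<^esub>" by (simp add: zero_Fp_xy fun_eq_iff)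
    then have "const_series (0 mod int p) \<odot>\<^bsub>M\<^esub> z = \<zero>\<^bsub>M\<^esub>"
      using M.smult_l_null[OF z(1)] by (simp only:)
    then have "m \<oplus>\<^bsub>M\<^esub> const_series (0 mod int p) \<odot>\<^bsub>M\<^esub> z = m"
      using m sub by (simp only: M.M.r_zero subset_iff)
    then show "m \<in> N'"
      using N'I[OF m const_mod[of 0]] by (simp only:)
  qed
  have rz: "r \<odot>\<^bsub>M\<^esub> z \<in> N'" if r: "r \<in> carrier (Fp_xy p)" for r
  proof -
    \<comment> \<open>Since x z and y z lie in N, a series acts on z modulo N through its constant
      term alone; s is the part without constant term.\<close>
    define s where "s = (\<lambda>i j. if i = 0 \<and> j = 0 then 0 else r i j)"
    have s: "s \<in> carrier (Fp_xy p)"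
      using r prime_gt_0_nat[OF p] by (auto simp: s_def carrier_Fp_xy)
    obtain r1 r2 where r12: "r1 \<in> carrier (Fp_xy p)" "r2 \<in> carrier (Fp_xy p)"
      "s = x_power 1 \<otimes>\<^bsub>Fp_xy p\<^esub> r1 \<oplus>\<^bsub>Fp_xy p\<^esub> y_power 1 \<otimes>\<^bsub>Fp_xy p\<^esub> r2"
      by (rule split_Fp_xy[OF p s, of 1]) (simp_all add: s_def)
    have "s \<odot>\<^bsub>M\<^esub> z = r1 \<odot>\<^bsub>M\<^esub> (x_power 1 \<odot>\<^bsub>M\<^esub> z) \<oplus>\<^bsub>M\<^esub> r2 \<odot>\<^bsub>M\<^esub> (y_power 1 \<odot>\<^bsub>M\<^esub> z)"
      unfolding r12(3) M.R.m_comm[OF xy(1) r12(1)] M.R.m_comm[OF xy(2) r12(2)]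
        M.smult_l_distr[OF M.R.m_closed[OF r12(1) xy(1)] M.R.m_closed[OF r12(2) xy(2)] z(1)]
        M.smult_assoc1[OF r12(1) xy(1) z(1)] M.smult_assoc1[OF r12(2) xy(2) z(1)] ..
    then have sz: "s \<odot>\<^bsub>M\<^esub> z \<in> N"
      using NE(5)[OF NE(4)[OF r12(1) z(3)] NE(4)[OF r12(2) z(4)]] by simp
    have c: "r 0 0 \<in> K" using r by (simp add: carrier_Fp_xy K_def)
    have "r = s \<oplus>\<^bsub>Fp_xy p\<^esub> const_series (r 0 0)"
      using carrier_mod[OF r] by (auto simp: s_def add_Fp_xy fun_eq_iff)
    then have "r \<odot>\<^bsub>M\<^esub> z = s \<odot>\<^bsub>M\<^esub> z \<oplus>\<^bsub>M\<^esub> const_series (r 0 0) \<odot>\<^bsub>M\<^esub> z"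
      using M.smult_l_distr[OF s K[OF c] z(1)] by simp
    then show ?thesis using N'I[OF sz c] by simp
  qed
  have smult: "r \<odot>\<^bsub>M\<^esub> w \<in> N'" if r: "r \<in> carrier (Fp_xy p)" and wN: "w \<in> N'" for r w
  proof -
    obtain m c where w: "m \<in> N" "c \<in> K" "w = m \<oplus>\<^bsub>M\<^esub> const_series c \<odot>\<^bsub>M\<^esub> z"
      using N'E[OF wN] by blast
    have "m \<in> carrier M" using w(1) sub by blast
    have "r \<odot>\<^bsub>M\<^esub> w = r \<odot>\<^bsub>M\<^esub> m \<oplus>\<^bsub>M\<^esub> (r \<otimes>\<^bsub>Fp_xy p\<^esub> const_series c) \<odot>\<^bsub>M\<^esub> z"
      unfolding w(3) M.smult_r_distr[OF r \<open>m \<in> carrier M\<close> cz[OF w(2)]] M.smult_assoc1[OF r K[OF w(2)] z(1)] ..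
    then show ?thesis
      using add[OF _ rz[OF M.R.m_closed[OF r K[OF w(2)]]]] N_N' NE(4)[OF r w(1)] by auto
  qed
  have N'_sub: "submodule N' (Fp_xy p) M"
  proof (rule M.submoduleI[OF subN'])
    show "\<zero>\<^bsub>M\<^esub> \<in> N'" using N0 N_N' by blast
    fix w assume w: "w \<in> N'"
    have "(\<ominus>\<^bsub>Fp_xy p\<^esub> \<one>\<^bsub>Fp_xy p\<^esub>) \<odot>\<^bsub>M\<^esub> w \<in> N'"
      using w by (intro smult) simp_all
    then show "\<ominus>\<^bsub>M\<^esub> w \<in> N'"
      using w subN' by (simp add: M.smult_l_minus subset_iff)
  qed (use add smult in auto)
  have "z \<in> N'"
    using rz[OF M.R.one_closed] z(1) by simp
  have "inj_on \<phi> (N \<times> K)"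
  proof (rule inj_onI, clarify)
    fix m c m' c' assume m: "m \<in> N" "m' \<in> N" and c: "c \<in> K" "c' \<in> K" and eq: "\<phi> (m, c) = \<phi> (m', c')"
    have mM: "m \<in> carrier M" "m' \<in> carrier M" using m sub by auto
    note czM = cz[OF c(1)] cz[OF c(2)]
    define e where "e = (c - c') mod int p"
    have e: "e \<in> K" unfolding e_def by (rule const_mod)
    have "const_series c = const_series e \<oplus>\<^bsub>Fp_xy p\<^esub> const_series c'"
      using c by (auto simp: add_Fp_xy fun_eq_iff e_def K_def mod_simps)
    then have ez: "const_series c \<odot>\<^bsub>M\<^esub> z = const_series e \<odot>\<^bsub>M\<^esub> z \<oplus>\<^bsub>M\<^esub> const_series c' \<odot>\<^bsub>M\<^esub> z"
      using M.smult_l_distr[OF K[OF e] K[OF c(2)] z(1)] by simp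
    have "(m \<oplus>\<^bsub>M\<^esub> const_series e \<odot>\<^bsub>M\<^esub> z) \<oplus>\<^bsub>M\<^esub> const_series c' \<odot>\<^bsub>M\<^esub> z = m' \<oplus>\<^bsub>M\<^esub> const_series c' \<odot>\<^bsub>M\<^esub> z"
      using eq ez mM czM cz[OF e] by (simp add: \<phi>_def M.M.a_assoc)
    then have me: "m \<oplus>\<^bsub>M\<^esub> const_series e \<odot>\<^bsub>M\<^esub> z = m'"
      using mM czM cz[OF e] by (simp add: M.add.right_cancel)
    then have "const_series e \<odot>\<^bsub>M\<^esub> z = \<ominus>\<^bsub>M\<^esub> m \<oplus>\<^bsub>M\<^esub> m'"
      unfolding me[symmetric] using mM(1) cz[OF e] by (simp only: M.M.r_neg1)
    then have eN: "const_series e \<odot>\<^bsub>M\<^esub> z \<in> N"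
      using NE(5)[OF NE(3)[OF m(1)] m(2)] by simp
    \<comment> \<open>A nonzero constant is a unit, so e z in N would put z into N.\<close>
    have "e = 0"
    proof (rule ccontr)
      assume "e \<noteq> 0"
      then have "\<not> int p dvd e"
        using e zdvd_not_zless[of e "int p"] by (auto simp: K_def)
      then have "coprime e (int p)"
        using p prime_imp_coprime[of "int p" e] by (simp add: coprime_commute)
      then obtain e' where e': "[e * e' = 1] (mod int p)"
        using cong_solve_coprime_int by blast
      have "\<one>\<^bsub>Fp_xy p\<^esub> = const_series (e' mod int p) \<otimes>\<^bsub>Fp_xy p\<^esub> const_series e"
        unfolding monomial_mult_Fp_xy[OF p K[OF e]] using e' prime_gt_1_nat[OF p]
        by (auto simp: fps2_def residue_ring_def fun_eq_iff cong_def mod_simps mult.commute)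
      then have "z = const_series (e' mod int p) \<odot>\<^bsub>M\<^esub> (const_series e \<odot>\<^bsub>M\<^esub> z)"
        using M.smult_assoc1[OF K[OF const_mod[of e']] K[OF e] z(1)] M.smult_one[OF z(1)] by simp
      then have "z \<in> N"
        using NE(4)[OF K[OF const_mod[of e']] eN] by simp
      then show False using z(2) by blast
    qed
    then have "c = c'"
      using c unfolding e_def K_def
      by (metis atLeastLessThan_iff mod_0_imp_dvd mod_eq_dvd_iff mod_pos_pos_trivial)
    then show "m = m' \<and> c = c'"
      using eq mM czM by (auto simp: \<phi>_def M.add.right_cancel)
  qed
  then have "card N' = card N * p"
    by (simp add: N'_def card_image card_cartesian_product K_def)
  then show thesis
    using that[OF N'_sub] N_N' \<open>z \<in> N'\<close> z(2) by (auto simp: mult.commute)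
qed

text \<open>Repeated extension by a factor p, starting from 0, gives a chain with log_p of the order
  many steps. No chain is longer: by Lagrange all orders are powers of p, and their exponents
  increase strictly along the chain.\<close>

lemma module_length_card:
  assumes p: "prime p" and M: "module (Fp_xy p) M" and fin: "finite (carrier M)"
    and nilp: "\<And>m. m \<in> carrier M \<Longrightarrow> x_power n \<odot>\<^bsub>M\<^esub> m = \<zero>\<^bsub>M\<^esub>"
      "\<And>m. m \<in> carrier M \<Longrightarrow> y_power n \<odot>\<^bsub>M\<^esub> m = \<zero>\<^bsub>M\<^esub>"
  shows "card (carrier M) = p ^ the_enat (module_length (Fp_xy p) M)"
proof -
  interpret M: module "Fp_xy p" M by (rule M)
  let ?chain = "\<lambda>C k. (\<forall>i\<le>k. submodule (C i) (Fp_xy p) M) \<and> (\<forall>i<k. C i \<subset> C (Suc i))"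
  \<comment> \<open>An arbitrary starting submodule N is allowed because the induction climbs from N
    towards M; only N = 0 is used in the end.\<close>
  have ex: "\<exists>k C. ?chain C k \<and> C 0 = N \<and> card (carrier M) = p ^ k * card N"
    if "submodule N (Fp_xy p) M" for N
    using that
  proof (induction "card (carrier M) - card N" arbitrary: N rule: less_induct)
    case less
    show ?case
    proof (cases "N = carrier M")
      case True
      then show ?thesis
        using less.prems by (intro exI[of _ 0] exI[of _ "\<lambda>_. N"]) simp
    next
      case False
      obtain N' where N': "submodule N' (Fp_xy p) M" "N \<subset> N'" "card N' = p * card N"
        using submodule_extend[OF p M fin nilp less.prems False] by blast
      have sub: "N' \<subseteq> carrier M"
        by (rule M.submoduleE(1)[OF N'(1)])
      then have "finite N'" using fin finite_subset by blast
      then have "card N < card N'" using N'(2) by (rule psubset_card_mono)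
      moreover have "card N' \<le> card (carrier M)" using sub fin by (rule card_mono[rotated])
      ultimately have "card (carrier M) - card N' < card (carrier M) - card N" by simp
      from less.hyps[OF this N'(1)]
      obtain k C where C: "?chain C k" "C 0 = N'" "card (carrier M) = p ^ k * card N'"
        by blast
      have "?chain (\<lambda>i. case i of 0 \<Rightarrow> N | Suc i \<Rightarrow> C i) (Suc k)"
        using C(1,2) less.prems N'(2) by (auto split: nat.splits)
      then show ?thesis
        using C(3) N'(3) by (intro exI[of _ "Suc k"] exI[of _ "\<lambda>i. case i of 0 \<Rightarrow> N | Suc i \<Rightarrow> C i"]) simp
    qed
  qed
  have "submodule {\<zero>\<^bsub>M\<^esub>} (Fp_xy p) M"
    by (rule M.submoduleI) auto
  from ex[OF this] obtain k C
    where "?chain C k \<and> C 0 = {\<zero>\<^bsub>M\<^esub>} \<and> card (carrier M) = p ^ k * card {\<zero>\<^bsub>M\<^esub>}"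
    by (elim exE)
  then have C: "?chain C k" "card (carrier M) = p ^ k * card {\<zero>\<^bsub>M\<^esub>}"
    by blast+
  have card: "card (carrier M) = p ^ k" using C(2) by simp
  have upper: "l \<le> k" if D: "?chain D l" for D l
  proof -
    have dvd: "card (D i) dvd p ^ k" if "i \<le> l" for i
    proof -
      have "subgroup (D i) (add_monoid M)"
        using D that by (blast intro: submodule.axioms(1))
      from group.lagrange[OF M.a_group this] show ?thesis
        by (simp add: order_def card) (metis dvd_triv_right)
    qed
    have "\<exists>j\<ge>i. card (D i) = p ^ j" if "i \<le> l" for i
      using that
    proof (induction i)
      case (Suc i)
      then obtain j where j: "j \<ge> i" "card (D i) = p ^ j" by auto
      have sm: "submodule (D (Suc i)) (Fp_xy p) M" using D Suc.prems by blast
      obtain j' where j': "card (D (Suc i)) = p ^ j'"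
        using dvd[OF Suc.prems] divides_primepow_nat[OF p] by blast
      have "finite (D (Suc i))"
        using M.submoduleE(1)[OF sm] fin finite_subset by blast
      then have "card (D i) < card (D (Suc i))"
        using D Suc.prems by (intro psubset_card_mono) auto
      then have "j < j'"
        using j(2) j' prime_gt_1_nat[OF p] by simp
      then show ?case using j j' by (intro exI[of _ j']) simp
    next
      case 0
      then show ?case
        using dvd divides_primepow_nat[OF p] by blast
    qed
    then obtain j where j: "j \<ge> l" "card (D l) = p ^ j" by blast
    have "card (D l) \<le> p ^ k"
      unfolding card[symmetric] using D M.submoduleE(1) fin by (intro card_mono) auto
    then have "j \<le> k"
      using j(2) prime_gt_1_nat[OF p] by simp
    then show ?thesis using j(1) by simp
  qed
  have "module_length (Fp_xy p) M = enat k"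
    unfolding module_length_def
  proof (rule antisym)
    show "Sup {enat n | n. \<exists>N. ?chain N n} \<le> enat k"
      by (rule Sup_least) (use upper in auto)
    show "enat k \<le> Sup {enat n | n. \<exists>N. ?chain N n}"
      by (rule Sup_upper) (use C(1) in blast)
  qed
  then show ?thesis by (simp add: card)
qed

section \<open>The quotient by the colon ideal as an image of multiplication\<close>

definition truncate :: "nat \<Rightarrow> (nat \<Rightarrow> nat \<Rightarrow> int) \<Rightarrow> nat \<times> nat \<Rightarrow> int" where
  "truncate q f \<tau> = (if \<tau> \<in> box q then f (fst \<tau>) (snd \<tau>) else 0)"

text \<open>Within the box only coefficients of r inside the box enter the product, and these are
  arbitrary residues. So the multiples of g^N modulo (x^q, y^q) are the image of the matrix.\<close>

lemma truncate_mult_image: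
  assumes p: "prime p"
  shows "(\<lambda>r. truncate q (r \<otimes>\<^bsub>Fp_xy p\<^esub> reduce_mod p (poly_g a b c u v) [^]\<^bsub>Fp_xy p\<^esub> N)) ` carrier (Fp_xy p)
    = mod_image p (box q) (box q) (shift_weight (gcoeff a b c u v N))"
    (is "?\<phi> ` _ = mod_image p _ _ ?w")
proof -
  have power: "reduce_mod p (poly_g a b c u v) [^]\<^bsub>Fp_xy p\<^esub> N = (\<lambda>i j. gcoeff a b c u v N i j mod int p)"
    unfolding reduce_mod_power[OF p] by (simp only: reduce_mod_def coeff_poly_g_power)
  have \<phi>: "?\<phi> r = mod_map p (box q) (box q) ?w (case_prod r)" for r
  proof (rule ext, clarify)
    fix i j
    show "?\<phi> r (i, j) = mod_map p (box q) (box q) ?w (case_prod r) (i, j)"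
    proof (cases "(i, j) \<in> box q")
      case True
      have "(\<Sum>\<sigma>\<in>box q. case_prod r \<sigma> * ?w \<sigma> (i, j)) = (\<Sum>\<sigma>\<in>{..i} \<times> {..j}. case_prod r \<sigma> * ?w \<sigma> (i, j))"
        using True by (intro sum.mono_neutral_right) (auto simp: shift_weight_def)
      also have "\<dots> = (\<Sum>k\<le>i. \<Sum>l\<le>j. r k l * gcoeff a b c u v N (i - k) (j - l))"
        unfolding sum.cartesian_product by (intro sum.cong refl) (auto simp: shift_weight_def)
      finally have "mod_map p (box q) (box q) ?w (case_prod r) (i, j)
          = (\<Sum>k\<le>i. \<Sum>l\<le>j. r k l * gcoeff a b c u v N (i - k) (j - l)) mod int p"
        using True by (simp add: mod_map_def)
      also have "\<dots> = (\<Sum>k\<le>i. \<Sum>l\<le>j. r k l * (gcoeff a b c u v N (i - k) (j - l) mod int p)) mod int p"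
        unfolding cong_def[symmetric] by (intro cong_sum cong_mult) (simp_all add: cong_def)
      finally show ?thesis
        using True by (simp add: truncate_def mult_Fp_xy[OF p] power)
    next
      case False
      then show ?thesis by (auto simp: truncate_def mod_map_def)
    qed
  qed
  show ?thesis
  proof (intro equalityI subsetI)
    fix F assume "F \<in> mod_image p (box q) (box q) ?w"
    then obtain h where h: "F = mod_map p (box q) (box q) ?w h" by (auto simp: mod_image_def)
    define r where "r = (\<lambda>k l. h (k, l) mod int p)"
    have "(\<Sum>\<sigma>\<in>box q. h \<sigma> * ?w \<sigma> \<tau>) mod int p = (\<Sum>\<sigma>\<in>box q. case_prod r \<sigma> * ?w \<sigma> \<tau>) mod int p" for \<tau>
      unfolding cong_def[symmetric] r_def by (intro cong_sum cong_mult) (auto simp: cong_def)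
    then have "F = ?\<phi> r"
      unfolding \<phi> h by (simp add: mod_map_def fun_eq_iff)
    moreover have "r \<in> carrier (Fp_xy p)"
      using prime_gt_0_nat[OF p] by (simp add: r_def carrier_Fp_xy)
    ultimately show "F \<in> ?\<phi> ` carrier (Fp_xy p)" by blast
  qed (auto simp: \<phi> mod_image_def)
qed

text \<open>The numerator in the sequence for the F-signature, with the exponent N left free so that
  rounding t p^e down can be compared with rounding it up.\<close>

definition colength :: "nat \<Rightarrow> nat \<Rightarrow> nat \<Rightarrow> nat \<Rightarrow> nat \<Rightarrow> nat \<Rightarrow> nat \<Rightarrow> nat \<Rightarrow> nat" where
  "colength a b c u v p e N = the_enat (module_length (Fp_xy p) (quotient_module (Fp_xy p)
    (colon_ideal (Fp_xy p) (frobenius_ideal p e) (reduce_mod p (poly_g a b c u v) [^]\<^bsub>Fp_xy p\<^esub> N))))"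

text \<open>Maps with equal fibres have images of equal size. This replaces the first isomorphism
  theorem for the coset map and multiplication by g^N.\<close>

lemma card_image_eqI:
  assumes "\<And>x y. x \<in> A \<Longrightarrow> y \<in> A \<Longrightarrow> f x = f y \<longleftrightarrow> g x = g y"
  shows "card (f ` A) = card (g ` A)" "finite (f ` A) \<longleftrightarrow> finite (g ` A)"
proof -
  have "bij_betw (\<lambda>y. g (inv_into A f y)) (f ` A) (g ` A)"
  proof (rule bij_betw_imageI)
    have g: "g (inv_into A f (f x)) = g x" if "x \<in> A" for x
      using that assms[of "inv_into A f (f x)" x] by (simp add: f_inv_into_f inv_into_into)
    show "inj_on (\<lambda>y. g (inv_into A f y)) (f ` A)"
      using assms g by (auto intro!: inj_onI)
    show "(\<lambda>y. g (inv_into A f y)) ` f ` A = g ` A"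
      unfolding image_image using g by (intro image_cong) auto
  qed
  then show "card (f ` A) = card (g ` A)" "finite (f ` A) \<longleftrightarrow> finite (g ` A)"
    by (auto simp: bij_betw_same_card bij_betw_finite)
qed

text \<open>The kernel of r \<mapsto> r g^N modulo (x^q, y^q) is the colon ideal, so its cosets
  correspond to the points of the image. The Frobenius ideal lies in the colon ideal, hence x^q and
  y^q annihilate the quotient, as the length formula requires.\<close>

lemma power_colength:
  assumes p: "prime p"
  shows "p ^ colength a b c u v p e N = card (mod_image p (box (p ^ e)) (box (p ^ e)) (shift_weight (gcoeff a b c u v N)))"
proof -
  interpret cring "Fp_xy p" by (rule cring_Fp_xy[OF p])
  define g where "g = reduce_mod p (poly_g a b c u v) [^]\<^bsub>Fp_xy p\<^esub> N"
  define I where "I = frobenius_ideal p e"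
  define J where "J = colon_ideal (Fp_xy p) I g"
  let ?\<phi> = "\<lambda>r. truncate (p ^ e) (r \<otimes>\<^bsub>Fp_xy p\<^esub> g)"
  have g: "g \<in> carrier (Fp_xy p)"
    unfolding g_def by (rule nat_pow_closed[OF reduce_mod_closed[OF p]])
  have J: "ideal J (Fp_xy p)"
    unfolding J_def I_def by (rule colon_ideal_ideal[OF frobenius_ideal_eq(2)[OF p] g])
  interpret J: ideal J "Fp_xy p" by (rule J)
  interpret Q: cring "Fp_xy p Quot J" by (rule J.quotient_is_cring[OF is_cring])
  have M: "module (Fp_xy p) (quotient_module (Fp_xy p) J)"
    by (rule module_quotient_module[OF J])
  have carrier: "carrier (quotient_module (Fp_xy p) J) = (\<lambda>r. J +>\<^bsub>Fp_xy p\<^esub> r) ` carrier (Fp_xy p)"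
    by (auto simp: quotient_module_def FactRing_def A_RCOSETS_defs a_r_coset_def)
  have eq: "J +>\<^bsub>Fp_xy p\<^esub> r = J +>\<^bsub>Fp_xy p\<^esub> s \<longleftrightarrow> ?\<phi> r = ?\<phi> s"
    if rs: "r \<in> carrier (Fp_xy p)" "s \<in> carrier (Fp_xy p)" for r s
  proof -
    have rg: "r \<otimes>\<^bsub>Fp_xy p\<^esub> g \<in> carrier (Fp_xy p)" "s \<otimes>\<^bsub>Fp_xy p\<^esub> g \<in> carrier (Fp_xy p)"
      using rs g by simp_all
    have "J +>\<^bsub>Fp_xy p\<^esub> r = J +>\<^bsub>Fp_xy p\<^esub> s \<longleftrightarrow> r \<ominus>\<^bsub>Fp_xy p\<^esub> s \<in> J"
      by (rule quotient_eq_iff_same_a_r_cos[OF J rs, symmetric])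
    also have "\<dots> \<longleftrightarrow> (r \<otimes>\<^bsub>Fp_xy p\<^esub> g) \<ominus>\<^bsub>Fp_xy p\<^esub> (s \<otimes>\<^bsub>Fp_xy p\<^esub> g) \<in> I"
    proof -
      have "(r \<ominus>\<^bsub>Fp_xy p\<^esub> s) \<otimes>\<^bsub>Fp_xy p\<^esub> g = (r \<otimes>\<^bsub>Fp_xy p\<^esub> g) \<ominus>\<^bsub>Fp_xy p\<^esub> (s \<otimes>\<^bsub>Fp_xy p\<^esub> g)"
        unfolding a_minus_def l_distr[OF rs(1) a_inv_closed[OF rs(2)] g] l_minus[OF rs(2) g] ..
      then show ?thesis
        using minus_closed[OF rs] by (simp only: J_def colon_ideal_def mem_Collect_eq simp_thms)
    qed
    also have "\<dots> \<longleftrightarrow> (\<forall>i j. i < p ^ e \<longrightarrow> j < p ^ e \<longrightarrow> (r \<otimes>\<^bsub>Fp_xy p\<^esub> g) i j = (s \<otimes>\<^bsub>Fp_xy p\<^esub> g) i j)"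
    proof -
      have "((r \<otimes>\<^bsub>Fp_xy p\<^esub> g) i j - (s \<otimes>\<^bsub>Fp_xy p\<^esub> g) i j) mod int p = 0
          \<longleftrightarrow> (r \<otimes>\<^bsub>Fp_xy p\<^esub> g) i j = (s \<otimes>\<^bsub>Fp_xy p\<^esub> g) i j" for i j
        by (simp only: mod_eq_0_iff_dvd mod_eq_dvd_iff[symmetric] carrier_mod[OF rg(1)] carrier_mod[OF rg(2)])
      moreover have "(r \<otimes>\<^bsub>Fp_xy p\<^esub> g) \<ominus>\<^bsub>Fp_xy p\<^esub> (s \<otimes>\<^bsub>Fp_xy p\<^esub> g) \<in> carrier (Fp_xy p)"
        using rg by simp
      ultimately show ?thesis
        unfolding I_def frobenius_ideal_eq(1)[OF p] mem_Collect_eq minus_Fp_xy[OF p rg] by simp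
    qed
    also have "\<dots> \<longleftrightarrow> ?\<phi> r = ?\<phi> s"
      by (auto simp: truncate_def fun_eq_iff)
    finally show ?thesis .
  qed
  have mod_image: "?\<phi> ` carrier (Fp_xy p) = mod_image p (box (p ^ e)) (box (p ^ e)) (shift_weight (gcoeff a b c u v N))"
    unfolding g_def by (rule truncate_mult_image[OF p])
  have card: "card (carrier (quotient_module (Fp_xy p) J)) = card (mod_image p (box (p ^ e)) (box (p ^ e)) (shift_weight (gcoeff a b c u v N)))"
    and "finite (carrier (quotient_module (Fp_xy p) J)) \<longleftrightarrow> finite (?\<phi> ` carrier (Fp_xy p))"
    unfolding carrier mod_image[symmetric] by (rule card_image_eqI[OF eq], assumption, assumption)+
  then have fin: "finite (carrier (quotient_module (Fp_xy p) J))"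
    unfolding mod_image by (simp add: finite_mod_image[OF prime_gt_0_nat[OF p]])
  have zero: "r \<odot>\<^bsub>quotient_module (Fp_xy p) J\<^esub> m = \<zero>\<^bsub>quotient_module (Fp_xy p) J\<^esub>"
    if r: "r \<in> I" and "m \<in> carrier (quotient_module (Fp_xy p) J)" for r m
  proof -
    have rc: "r \<in> carrier (Fp_xy p)"
      using r unfolding I_def frobenius_ideal_eq(1)[OF p] by simp
    have "r \<in> J"
      using rc ideal.I_r_closed[OF frobenius_ideal_eq(2)[OF p] _ g] r
      unfolding J_def colon_ideal_def I_def by blast
    then have "J +>\<^bsub>Fp_xy p\<^esub> r = \<zero>\<^bsub>Fp_xy p Quot J\<^esub>"
      by (simp add: J.a_rcos_const FactRing_def)
    then show ?thesis
      using that by (simp add: quotient_module_def)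
  qed
  have "x_power (p ^ e) \<in> I" "y_power (p ^ e) \<in> I"
    using power_closed_Fp_xy[OF p] unfolding I_def frobenius_ideal_eq(1)[OF p] by auto
  then have "card (carrier (quotient_module (Fp_xy p) J)) = p ^ the_enat (module_length (Fp_xy p) (quotient_module (Fp_xy p) J))"
    by (intro module_length_card[OF p M fin, of "p ^ e"] zero)
  then show ?thesis
    unfolding card by (simp only: colength_def J_def I_def g_def)
qed

text \<open>Every multiple of g^N' is a multiple of g^N, so the images are nested.\<close>

lemma colength_antimono:
  assumes p: "prime p" and "N \<le> N'"
  shows "colength a b c u v p e N' \<le> colength a b c u v p e N"
proof -
  interpret cring "Fp_xy p" by (rule cring_Fp_xy[OF p])
  let ?G = "reduce_mod p (poly_g a b c u v)"
  have G: "?G \<in> carrier (Fp_xy p)" by (rule reduce_mod_closed[OF p])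
  have "mod_image p (box (p ^ e)) (box (p ^ e)) (shift_weight (gcoeff a b c u v N'))
      \<subseteq> mod_image p (box (p ^ e)) (box (p ^ e)) (shift_weight (gcoeff a b c u v N))"
    unfolding truncate_mult_image[OF p, symmetric]
  proof (rule image_subsetI)
    fix r assume r: "r \<in> carrier (Fp_xy p)"
    have "r \<otimes>\<^bsub>Fp_xy p\<^esub> ?G [^]\<^bsub>Fp_xy p\<^esub> N' = (r \<otimes>\<^bsub>Fp_xy p\<^esub> ?G [^]\<^bsub>Fp_xy p\<^esub> (N' - N)) \<otimes>\<^bsub>Fp_xy p\<^esub> ?G [^]\<^bsub>Fp_xy p\<^esub> N"
      using r G assms(2) by (simp add: m_assoc nat_pow_mult)
    then show "truncate (p ^ e) (r \<otimes>\<^bsub>Fp_xy p\<^esub> ?G [^]\<^bsub>Fp_xy p\<^esub> N')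
        \<in> (\<lambda>r. truncate (p ^ e) (r \<otimes>\<^bsub>Fp_xy p\<^esub> ?G [^]\<^bsub>Fp_xy p\<^esub> N)) ` carrier (Fp_xy p)"
      using r G by (intro image_eqI[where x = "r \<otimes>\<^bsub>Fp_xy p\<^esub> ?G [^]\<^bsub>Fp_xy p\<^esub> (N' - N)"]) simp_all
  qed
  then have "p ^ colength a b c u v p e N' \<le> p ^ colength a b c u v p e N"
    unfolding power_colength[OF p] by (intro card_mono finite_mod_image prime_gt_0_nat[OF p]) auto
  then show ?thesis
    using prime_gt_1_nat[OF p] by simp
qed

lemma colength_frobenius:
  assumes p: "prime p" and "u > 0"
  shows "colength a b c u v p (Suc e) (p * N) = p\<^sup>2 * colength a b c u v p e N"
proof -
  have "p ^ colength a b c u v p (Suc e) (p * N)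
      = card (mod_image p (box (p * p ^ e)) (box (p * p ^ e)) (shift_weight (gcoeff a b c u v (p * N))))"
    by (simp only: power_colength[OF p] power_Suc)
  also have "\<dots> = (p ^ colength a b c u v p e N) ^ p\<^sup>2"
    by (simp only: power_colength[OF p] card_mod_image_frobenius[OF assms])
  also have "\<dots> = p ^ (p\<^sup>2 * colength a b c u v p e N)"
    by (simp only: power_mult[symmetric] mult.commute)
  finally have "p ^ colength a b c u v p (Suc e) (p * N) = p ^ (p\<^sup>2 * colength a b c u v p e N)" .
  then show ?thesis
    using prime_gt_1_nat[OF p] by simp
qed

lemma colength_le:
  assumes p: "prime p"
  shows "colength a b c u v p e N \<le> p ^ (2 * e)"
proof -
  have "p ^ colength a b c u v p e N \<le> p ^ card (box (p ^ e))"
    unfolding power_colength[OF p] by (intro card_mod_image_le_target prime_gt_0_nat[OF p]) simp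
  then show ?thesis
    using prime_gt_1_nat[OF p] by (simp add: power_add[symmetric] mult_2)
qed

section \<open>Limits\<close>

text \<open>Count the points below d \<mapsto> min(d + 1, K, S - 1 - d) by horizontal layers: the
  layer k < K occupies the degrees from k to S - 2 - k. The bound on D ensures that no layer is cut
  off.\<close>

lemma sum_min_eq:
  fixes S K D :: nat
  assumes "S \<le> D"
  shows "(\<Sum>d<D. min (min (d + 1) K) (S - 1 - d)) = (\<Sum>k<K. S - 1 - 2 * k)"
proof (induction K)
  case (Suc K)
  have "(\<Sum>d<D. min (min (d + 1) (Suc K)) (S - 1 - d))
      = (\<Sum>d<D. min (min (d + 1) K) (S - 1 - d) + (if d \<in> {K..<S - 1 - K} then 1 else 0))"
  proof (rule sum.cong[OF refl])
    fix d
    have "d \<in> {K..<S - 1 - K} \<longleftrightarrow> K \<le> d \<and> K < S - 1 - d" by auto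
    then show "min (min (d + 1) (Suc K)) (S - 1 - d)
        = min (min (d + 1) K) (S - 1 - d) + (if d \<in> {K..<S - 1 - K} then 1 else 0)"
      by (simp add: min_def)
  qed
  also have "\<dots> = (\<Sum>d<D. min (min (d + 1) K) (S - 1 - d)) + card ({..<D} \<inter> {K..<S - 1 - K})"
    by (simp add: sum.distrib sum.If_cases Int_def)
  also have "{..<D} \<inter> {K..<S - 1 - K} = {K..<S - 1 - K}"
    using assms by auto
  finally show ?case
    using Suc.IH by simp
qed simp

text \<open>For K, S \<ge> 0 the area below d \<mapsto> min(d, K, S - d) on [0, S]: a triangle of
  base S and height S/2, minus the similar triangle of base S - 2K above height K.\<close>

definition trapezoid :: "real \<Rightarrow> real \<Rightarrow> real" where
  "trapezoid K S = (S\<^sup>2 - (max 0 (S - 2 * K))\<^sup>2) / 4"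

text \<open>The last term is S + 1 - 2K, so the hypothesis keeps all subtractions exact and the sum
  is an arithmetic progression.\<close>

lemma sum_trapezoid_le:
  "2 * K \<le> S + 1 \<Longrightarrow> real (\<Sum>k<K. S - 1 - 2 * k) = real K * (real S - real K)"
proof (induction K)
  case (Suc K)
  then have "real (S - 1 - 2 * K) = real S - 1 - 2 * real K"
    by (simp add: of_nat_diff)
  then show ?case
    using Suc by (simp add: algebra_simps)
qed simp

text \<open>There is no error for 2K \<le> S. Otherwise the layers from (S + 1) div 2 on are empty,
  and the remaining sum misses S^2/4 by at most 1/4, according to the parity of S.\<close>

lemma sum_trapezoid:
  "\<bar>real (\<Sum>k<K. S - 1 - 2 * k) - trapezoid (real K) (real S)\<bar> \<le> 1"
proof (cases "2 * K \<le> S")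
  case True
  then have "max 0 (real S - 2 * real K) = real S - 2 * real K" by simp
  then show ?thesis
    using True by (subst sum_trapezoid_le) (simp_all add: trapezoid_def power2_eq_square field_simps)
next
  case False
  define L where "L = (S + 1) div 2"
  have L: "2 * L \<le> S + 1" "S \<le> 2 * L" "L \<le> K"
    using False by (simp_all add: L_def)
  have "(\<Sum>k<K. S - 1 - 2 * k) = (\<Sum>k<L. S - 1 - 2 * k)"
    using L by (intro sum.mono_neutral_right) auto
  then have "real (\<Sum>k<K. S - 1 - 2 * k) = real L * (real S - real L)"
    using sum_trapezoid_le[OF L(1)] by simp
  moreover have "max 0 (real S - 2 * real K) = 0" using False by simp
  moreover have "S = 2 * L \<or> S + 1 = 2 * L" using L by linarith
  then have "real S = 2 * real L \<or> real S = 2 * real L - 1" by linarith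
  then have "4 * (real L * (real S - real L)) = (real S)\<^sup>2 \<or> 4 * (real L * (real S - real L)) = (real S)\<^sup>2 - 1"
    by (elim disjE) (simp_all only:, simp_all add: power2_eq_square algebra_simps)
  ultimately show ?thesis
    unfolding trapezoid_def by auto
qed

text \<open>Rounding up adds less than 1 and the shift by \<alpha> < u removes less than 1.\<close>

lemma slice_bounds:
  assumes "u > 0" "\<alpha> < u" "l \<le> p"
  shows "\<bar>real (slice u (p - l - \<alpha>)) - (real p - real l) / real u\<bar> \<le> 1"
proof -
  define m where "m = slice u (p - l - \<alpha>)"
  have "u * m \<le> p - l - \<alpha> + u - 1"
    by (simp add: m_def slice_def)
  then have "u * m + l \<le> p + u"
    using assms by linarith
  then have 1: "real u * real m + real l \<le> real p + real u"
    by (metis of_nat_add of_nat_le_iff of_nat_mult)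
  have "\<not> m < slice u (p - l - \<alpha>)" by (simp add: m_def)
  then have "p \<le> u * m + l + \<alpha>"
    unfolding less_slice_iff[OF assms(1)] by linarith
  then have "p \<le> u * m + l + u"
    using assms by linarith
  then have 2: "real p \<le> real u * real m + real l + real u"
    by (metis of_nat_add of_nat_le_iff of_nat_mult)
  show ?thesis
    unfolding m_def[symmetric] using 1 2 assms by (simp add: abs_le_iff field_simps)
qed

section \<open>Asymptotics of the colength for q = p\<close>

lemma tendsto_divide_bounded_diff:
  fixes f :: "nat \<Rightarrow> real"
  assumes "eventually (\<lambda>p. \<bar>f p - g p\<bar> \<le> C) at_top" "(\<lambda>p. g p / real p) \<longlonglongrightarrow> l"
  shows "(\<lambda>p. f p / real p) \<longlonglongrightarrow> l"
proof (rule Lim_transform[OF assms(2)], rule tendsto_rabs_zero_cancel, rule tendsto_sandwich)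
  show "eventually (\<lambda>p. 0 \<le> \<bar>f p / real p - g p / real p\<bar>) at_top" by simp
  show "eventually (\<lambda>p. \<bar>f p / real p - g p / real p\<bar> \<le> C / real p) at_top"
    using assms(1)
  proof eventually_elim
    case (elim p)
    then show ?case
      by (simp add: diff_divide_distrib[symmetric] abs_divide divide_right_mono)
  qed
  show "(\<lambda>p. C / real p) \<longlonglongrightarrow> 0"
    by (rule lim_const_over_n)
qed (rule tendsto_const)

text \<open>The gap (1 - kt) p eventually exceeds the error k. From then on p - k N is an exact
  difference.\<close>

lemma linear_eventually_le:
  assumes "real k * t < 1" "\<And>p. \<bar>real (N p) - t * real p\<bar> \<le> 1"
  shows "eventually (\<lambda>p. k * N p \<le> p) at_top"
proof -
  have "eventually (\<lambda>p. real k / (1 - real k * t) \<le> real p) at_top"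
    using filterlim_real_sequentially by (simp add: filterlim_at_top)
  then show ?thesis
  proof eventually_elim
    case (elim p)
    then have "real k \<le> real p - real k * t * real p"
      using assms(1) by (simp add: field_simps)
    moreover have "real k * real (N p) \<le> real k * (t * real p + 1)"
      using assms(2)[of p] by (intro mult_left_mono) auto
    ultimately have "real k * real (N p) \<le> real p"
      by (simp add: algebra_simps)
    then show ?case
      by (metis of_nat_le_iff of_nat_mult)
  qed
qed

text \<open>After rescaling by p, all u * v residue classes have the same limiting trapezoid. Its
  area is continuous and homogeneous of degree 2 in (K, S), so the bounded error of the lattice sums
  vanishes against p^2. The hypothesis on N covers both ways of rounding tp.\<close>

lemma colength_one_limit:
  fixes t :: real
  assumes uv: "u > 0" "v > 0" and t: "real a * t < 1" "real b * t < 1" "real c * t < 1"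
    and N: "\<And>p. \<bar>real (N p) - t * real p\<bar> \<le> 1"
  defines "\<alpha>' \<equiv> (1 - real a * t) / real u" and "\<beta>' \<equiv> (1 - real b * t) / real v" and "\<gamma>' \<equiv> real c * t"
  shows "((\<lambda>p. real (colength a b c u v p 1 (N p)) / (real p)\<^sup>2) \<longlongrightarrow>
    real u * real v * trapezoid (min (min \<alpha>' \<beta>') (1 - \<gamma>')) (max 0 (\<alpha>' + \<beta>' - \<gamma>'))) at_top_primes"
proof -
  define m where "m \<alpha> p = slice u (p - a * N p - \<alpha>)" for \<alpha> p
  define n where "n \<beta> p = slice v (p - b * N p - \<beta>)" for \<beta> p
  define K where "K \<alpha> \<beta> p = min (min (m \<alpha> p) (n \<beta> p)) (p - c * N p)" for \<alpha> \<beta> p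
  define S where "S \<alpha> \<beta> p = m \<alpha> p + n \<beta> p - c * N p" for \<alpha> \<beta> p
  define \<Phi> where "\<Phi> = trapezoid (min (min \<alpha>' \<beta>') (1 - \<gamma>')) (max 0 (\<alpha>' + \<beta>' - \<gamma>'))"
  have pp: "(\<lambda>p. real p / real p) \<longlonglongrightarrow> 1"
    by (rule tendsto_eventually) (auto intro!: eventually_at_top_linorderI[of 1])
  have tp: "(\<lambda>p. t * real p / real p) \<longlonglongrightarrow> t"
    using tendsto_mult_left[OF pp, of t] by (simp only: times_divide_eq_right mult_1_right)
  have Np: "(\<lambda>p. real (N p) / real p) \<longlonglongrightarrow> t"
    using N by (intro tendsto_divide_bounded_diff[OF _ tp]) (rule eventuallyI)
  have kN: "(\<lambda>p. (real p - real (k * N p)) / real w / real p) \<longlonglongrightarrow> (1 - real k * t) / real w" for k w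
  proof -
    have "(\<lambda>p. (real p / real p - real k * (real (N p) / real p)) / real w) \<longlonglongrightarrow> (1 - real k * t) / real w"
      by (cases "w = 0") (simp, intro tendsto_divide tendsto_diff tendsto_mult tendsto_const pp Np, simp)
    then show ?thesis
      by (simp only: of_nat_mult times_divide_eq_right diff_divide_distrib[symmetric] divide_divide_eq_left mult.commute)
  qed
  have mlim: "(\<lambda>p. real (m \<alpha> p) / real p) \<longlonglongrightarrow> \<alpha>'" if "\<alpha> < u" for \<alpha>
    unfolding \<alpha>'_def
    by (rule tendsto_divide_bounded_diff[OF eventually_mono[OF linear_eventually_le[OF t(1) N]] kN])
       (unfold m_def, rule slice_bounds[OF uv(1) that])
  have nlim: "(\<lambda>p. real (n \<beta> p) / real p) \<longlonglongrightarrow> \<beta>'" if "\<beta> < v" for \<beta>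
    unfolding \<beta>'_def
    by (rule tendsto_divide_bounded_diff[OF eventually_mono[OF linear_eventually_le[OF t(2) N]] kN])
       (unfold n_def, rule slice_bounds[OF uv(2) that])
  have clim: "(\<lambda>p. real (p - c * N p) / real p) \<longlonglongrightarrow> 1 - \<gamma>'"
  proof (rule Lim_transform_eventually)
    show "(\<lambda>p. (real p - real (c * N p)) / real 1 / real p) \<longlonglongrightarrow> 1 - \<gamma>'"
      using kN[of c 1] by (simp add: \<gamma>'_def)
    show "eventually (\<lambda>p. (real p - real (c * N p)) / real 1 / real p = real (p - c * N p) / real p) at_top"
      using linear_eventually_le[OF t(3) N] by eventually_elim (simp add: of_nat_diff)
  qed
  have block_lim: "(\<lambda>p. real (\<Sum>k<K \<alpha> \<beta> p. S \<alpha> \<beta> p - 1 - 2 * k) / (real p)\<^sup>2) \<longlonglongrightarrow> \<Phi>" if "\<alpha> < u" "\<beta> < v" for \<alpha> \<beta>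
  proof (rule Lim_transform)
    have Klim: "(\<lambda>p. real (K \<alpha> \<beta> p) / real p) \<longlonglongrightarrow> min (min \<alpha>' \<beta>') (1 - \<gamma>')"
    proof -
      have "(\<lambda>p. min (min (real (m \<alpha> p) / real p) (real (n \<beta> p) / real p)) (real (p - c * N p) / real p))
          \<longlonglongrightarrow> min (min \<alpha>' \<beta>') (1 - \<gamma>')"
        using that by (intro tendsto_min mlim nlim clim)
      moreover have "min (x / real p) (y / real p) = min x y / real p" for x y p
        by (simp add: min_def divide_right_mono divide_le_cancel)
      ultimately show ?thesis
        unfolding K_def of_nat_min by simp
    qed
    have Slim: "(\<lambda>p. real (S \<alpha> \<beta> p) / real p) \<longlonglongrightarrow> max 0 (\<alpha>' + \<beta>' - \<gamma>')"
    proof -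
      have "(\<lambda>p. max 0 (real (m \<alpha> p) / real p + real (n \<beta> p) / real p - real c * (real (N p) / real p)))
          \<longlonglongrightarrow> max 0 (\<alpha>' + \<beta>' - \<gamma>')"
        unfolding \<gamma>'_def using that by (intro tendsto_max tendsto_const tendsto_add tendsto_diff tendsto_mult mlim nlim Np)
      moreover have "max 0 (real (m \<alpha> p) / real p + real (n \<beta> p) / real p - real c * (real (N p) / real p))
          = real (S \<alpha> \<beta> p) / real p" for p
      proof -
        have "real (S \<alpha> \<beta> p) = max 0 (real (m \<alpha> p) + real (n \<beta> p) - real c * real (N p))"
          unfolding S_def by (cases "c * N p \<le> m \<alpha> p + n \<beta> p") (simp_all add: of_nat_diff flip: of_nat_mult of_nat_add)
        moreover have "max 0 (x / real p) = max 0 x / real p" for x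
          by (simp add: max_def divide_le_0_iff zero_le_divide_iff)
        ultimately show ?thesis
          by (simp add: add_divide_distrib[symmetric] diff_divide_distrib[symmetric])
      qed
      ultimately show ?thesis by simp
    qed
    show "(\<lambda>p. trapezoid (real (K \<alpha> \<beta> p) / real p) (real (S \<alpha> \<beta> p) / real p)) \<longlonglongrightarrow> \<Phi>"
      unfolding \<Phi>_def trapezoid_def by (intro tendsto_intros tendsto_max Klim Slim) simp
    have scale: "trapezoid (x / real p) (y / real p) = trapezoid x y / (real p)\<^sup>2" for x y p
    proof -
      have "max 0 (y / real p - 2 * (x / real p)) = max 0 (y - 2 * x) / real p"
        by (simp add: max_def diff_divide_distrib[symmetric] divide_le_0_iff zero_le_divide_iff)
      then show ?thesis
        by (simp add: trapezoid_def power_divide diff_divide_distrib)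
    qed
    show "(\<lambda>p. real (\<Sum>k<K \<alpha> \<beta> p. S \<alpha> \<beta> p - 1 - 2 * k) / (real p)\<^sup>2
        - trapezoid (real (K \<alpha> \<beta> p) / real p) (real (S \<alpha> \<beta> p) / real p)) \<longlonglongrightarrow> 0"
    proof (rule tendsto_rabs_zero_cancel, rule tendsto_sandwich[where f = "\<lambda>_. 0"])
      show "eventually (\<lambda>p. \<bar>real (\<Sum>k<K \<alpha> \<beta> p. S \<alpha> \<beta> p - 1 - 2 * k) / (real p)\<^sup>2
          - trapezoid (real (K \<alpha> \<beta> p) / real p) (real (S \<alpha> \<beta> p) / real p)\<bar> \<le> 1 / (real p)\<^sup>2) at_top"
        unfolding scale diff_divide_distrib[symmetric] abs_divide abs_power2
        using sum_trapezoid by (intro always_eventually allI divide_right_mono) auto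
      show "(\<lambda>p. 1 / (real p)\<^sup>2) \<longlonglongrightarrow> 0"
        using tendsto_power[OF lim_1_over_n, of 2] by (simp add: power_divide)
    qed (auto intro: tendsto_const)
  qed
  have "(\<lambda>p. \<Sum>\<alpha><u. \<Sum>\<beta><v. real (\<Sum>k<K \<alpha> \<beta> p. S \<alpha> \<beta> p - 1 - 2 * k) / (real p)\<^sup>2)
      \<longlonglongrightarrow> (\<Sum>\<alpha><u. \<Sum>\<beta><v. \<Phi>)"
    by (intro tendsto_sum block_lim) auto
  then have lim: "((\<lambda>p. \<Sum>\<alpha><u. \<Sum>\<beta><v. real (\<Sum>k<K \<alpha> \<beta> p. S \<alpha> \<beta> p - 1 - 2 * k) / (real p)\<^sup>2)
      \<longlongrightarrow> real u * real v * \<Phi>) at_top_primes"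
    unfolding at_top_primes_def by (intro tendsto_mono[OF inf_le1]) (simp add: mult.assoc)
  have "eventually (\<lambda>p. (\<Sum>\<alpha><u. \<Sum>\<beta><v. real (\<Sum>k<K \<alpha> \<beta> p. S \<alpha> \<beta> p - 1 - 2 * k) / (real p)\<^sup>2)
      = real (colength a b c u v p 1 (N p)) / (real p)\<^sup>2) at_top_primes"
    unfolding at_top_primes_def eventually_inf_principal
    using linear_eventually_le[OF t(3) N]
  proof eventually_elim
    case (elim p)
    show ?case
    proof
      assume "p \<in> {p. prime p}"
      then have p: "prime p" by simp
      \<comment> \<open>Needed so that the degrees d < 2 * p exhaust the support of the
        summand.\<close>
      have S_le: "S \<alpha> \<beta> p \<le> 2 * p" for \<alpha> \<beta>
      proof -
        have "slice w l \<le> l" if "w > 0" for w l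
          using less_slice_iff[OF that, of l l] that by (cases w) auto
        then have "m \<alpha> p \<le> p" "n \<beta> p \<le> p"
          unfolding m_def n_def using uv by (meson diff_le_self le_trans)+
        then show ?thesis
          unfolding S_def by simp
      qed
      have "p ^ colength a b c u v p 1 (N p) = p ^ (\<Sum>\<alpha><u. \<Sum>\<beta><v. \<Sum>d<2 * p.
          min (min (d + 1) (K \<alpha> \<beta> p)) (S \<alpha> \<beta> p - 1 - d))"
        unfolding power_colength[OF p] power_one_right K_def S_def m_def n_def
        by (rule card_mod_image_gcoeff[OF p uv elim])
      then have "colength a b c u v p 1 (N p) = (\<Sum>\<alpha><u. \<Sum>\<beta><v. \<Sum>d<2 * p.
          min (min (d + 1) (K \<alpha> \<beta> p)) (S \<alpha> \<beta> p - 1 - d))"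
        using prime_gt_1_nat[OF p] by simp
      also have "\<dots> = (\<Sum>\<alpha><u. \<Sum>\<beta><v. \<Sum>k<K \<alpha> \<beta> p. S \<alpha> \<beta> p - 1 - 2 * k)"
        by (intro sum.cong refl sum_min_eq S_le)
      finally show "(\<Sum>\<alpha><u. \<Sum>\<beta><v. real (\<Sum>k<K \<alpha> \<beta> p. S \<alpha> \<beta> p - 1 - 2 * k) / (real p)\<^sup>2)
          = real (colength a b c u v p 1 (N p)) / (real p)\<^sup>2"
        by (simp add: sum_divide_distrib)
    qed
  qed
  then show ?thesis
    unfolding \<Phi>_def[symmetric] by (rule Lim_transform_eventually[OF lim])
qed

section \<open>From q = p to the F-signature\<close>

lemma F_signature_bounds:
  fixes t :: real
  assumes p: "prime p" and "u > 0" and t: "t \<ge> 0"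
  shows "real (colength a b c u v p 1 (nat \<lceil>t * real p\<rceil>)) / (real p)\<^sup>2
      \<le> F_signature p (reduce_mod p (poly_g a b c u v)) t"
    and "F_signature p (reduce_mod p (poly_g a b c u v)) t
      \<le> real (colength a b c u v p 1 (nat \<lfloor>t * real p\<rfloor>)) / (real p)\<^sup>2"
proof -
  define L where "L e N = real (colength a b c u v p e N)" for e N
  define x where "x e = L e (nat \<lceil>t * real p ^ e\<rceil>) / real p ^ (2 * e)" for e
  have p0: "real p > 0" using prime_gt_0_nat[OF p] by simp
  have x_F: "F_signature p (reduce_mod p (poly_g a b c u v)) t = lim x"
    unfolding F_signature_def x_def L_def colength_def ..
  have frob: "L (Suc e) (p * N) / real p ^ (2 * Suc e) = L e N / real p ^ (2 * e)" for e N
    using p0 by (simp add: L_def colength_frobenius[OF assms(1,2)] power_add power2_eq_square)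
  have anti: "L e N' / real p ^ (2 * e) \<le> L e N / real p ^ (2 * e)" if "N \<le> N'" for e N N'
    using colength_antimono[OF p that] p0 by (simp add: L_def divide_right_mono)
  \<comment> \<open>Frobenius turns the exponent \<lceil>t p^e\<rceil> into p times it, which is at
    least \<lceil>t p^(e+1)\<rceil>; a smaller exponent has the larger colength.\<close>
  have "x e \<le> x (Suc e)" for e
  proof -
    have "t * real p ^ Suc e \<le> real p * real_of_int \<lceil>t * real p ^ e\<rceil>"
      using p0 le_of_int_ceiling[of "t * real p ^ e"] by (simp add: mult.left_commute)
    then have "\<lceil>t * real p ^ Suc e\<rceil> \<le> int p * \<lceil>t * real p ^ e\<rceil>"
      by (simp add: ceiling_le_iff)
    then have "nat \<lceil>t * real p ^ Suc e\<rceil> \<le> p * nat \<lceil>t * real p ^ e\<rceil>"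
      by (metis nat_int nat_le_iff nat_mono nat_mult_distrib of_nat_0_le_iff)
    then have "L (Suc e) (p * nat \<lceil>t * real p ^ e\<rceil>) / real p ^ (2 * Suc e) \<le> x (Suc e)"
      unfolding x_def by (rule anti)
    then show ?thesis
      unfolding frob x_def .
  qed
  then have inc: "incseq x" by (rule incseq_SucI)
  have "x e \<le> 1" for e
  proof -
    have "real (colength a b c u v p e N) \<le> real p ^ (2 * e)" for N
      using colength_le[OF p] by (metis of_nat_le_iff of_nat_power)
    then show ?thesis
      using p0 by (simp add: x_def L_def)
  qed
  \<comment> \<open>Convergence has to be established before \<open>lim\<close> says
    anything.\<close>
  then obtain l where l: "x \<longlonglongrightarrow> l"
    using incseq_convergent[OF inc] by blast
  then have lim: "lim x = l" by (rule limI)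
  have "x 1 \<le> l"
    by (rule incseq_le[OF inc l])
  then show "real (colength a b c u v p 1 (nat \<lceil>t * real p\<rceil>)) / (real p)\<^sup>2
      \<le> F_signature p (reduce_mod p (poly_g a b c u v)) t"
    by (simp add: x_F lim x_def L_def)
  have frob': "L (Suc e) (p ^ e * N) / real p ^ (2 * Suc e) = L 1 N / (real p)\<^sup>2" for e N
  proof (induction e)
    case (Suc e)
    then show ?case
      using frob[of "Suc e" "p ^ e * N"] by (simp only: power_Suc mult.assoc)
  qed simp
  \<comment> \<open>Applying Frobenius e times to the exponent \<lfloor>tp\<rfloor> gives p^e
    \<lfloor>tp\<rfloor>, which is at most \<lceil>t p^(e+1)\<rceil>.\<close>
  have "x (Suc e) \<le> L 1 (nat \<lfloor>t * real p\<rfloor>) / (real p)\<^sup>2" for e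
  proof -
    have "real (p ^ e * nat \<lfloor>t * real p\<rfloor>) = real p ^ e * real_of_int \<lfloor>t * real p\<rfloor>"
      using t p0 by simp
    also have "\<dots> \<le> real p ^ e * (t * real p)"
      using p0 by (intro mult_left_mono of_int_floor_le) simp
    also have "\<dots> \<le> real_of_int \<lceil>t * real p ^ Suc e\<rceil>"
      using le_of_int_ceiling[of "t * real p ^ Suc e"] by (simp add: mult_ac)
    finally have "p ^ e * nat \<lfloor>t * real p\<rfloor> \<le> nat \<lceil>t * real p ^ Suc e\<rceil>"
      by linarith
    then show ?thesis
      unfolding x_def frob'[of e, symmetric] by (rule anti)
  qed
  then have "l \<le> L 1 (nat \<lfloor>t * real p\<rfloor>) / (real p)\<^sup>2"
    by (intro LIMSEQ_le_const2[OF LIMSEQ_Suc[OF l]]) auto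
  then show "F_signature p (reduce_mod p (poly_g a b c u v)) t
      \<le> real (colength a b c u v p 1 (nat \<lfloor>t * real p\<rfloor>)) / (real p)\<^sup>2"
    by (simp add: x_F lim L_def)
qed

lemma F_signature_limit:
  fixes t :: real
  assumes uv: "u > 0" "v > 0" and "t \<ge> 0" and t: "real a * t < 1" "real b * t < 1" "real c * t < 1"
  defines "\<alpha>' \<equiv> (1 - real a * t) / real u" and "\<beta>' \<equiv> (1 - real b * t) / real v" and "\<gamma>' \<equiv> real c * t"
  shows "((\<lambda>p. F_signature p (reduce_mod p (poly_g a b c u v)) t) \<longlongrightarrow>
    real u * real v * trapezoid (min (min \<alpha>' \<beta>') (1 - \<gamma>')) (max 0 (\<alpha>' + \<beta>' - \<gamma>'))) at_top_primes"
proof (rule tendsto_sandwich)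
  have prime: "eventually prime at_top_primes"
    unfolding at_top_primes_def eventually_inf_principal by simp
  show "eventually (\<lambda>p. real (colength a b c u v p 1 (nat \<lceil>t * real p\<rceil>)) / (real p)\<^sup>2
      \<le> F_signature p (reduce_mod p (poly_g a b c u v)) t) at_top_primes"
    using prime by eventually_elim (rule F_signature_bounds(1)[OF _ uv(1) assms(3)])
  show "eventually (\<lambda>p. F_signature p (reduce_mod p (poly_g a b c u v)) t
      \<le> real (colength a b c u v p 1 (nat \<lfloor>t * real p\<rfloor>)) / (real p)\<^sup>2) at_top_primes"
    using prime by eventually_elim (rule F_signature_bounds(2)[OF _ uv(1) assms(3)])
  have "\<bar>real (nat \<lceil>t * real p\<rceil>) - t * real p\<bar> \<le> 1" "\<bar>real (nat \<lfloor>t * real p\<rfloor>) - t * real p\<bar> \<le> 1" for p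
  proof -
    have "0 \<le> t * real p" using assms(3) by simp
    then show "\<bar>real (nat \<lceil>t * real p\<rceil>) - t * real p\<bar> \<le> 1" "\<bar>real (nat \<lfloor>t * real p\<rfloor>) - t * real p\<bar> \<le> 1"
      by linarith+
  qed
  then show "((\<lambda>p. real (colength a b c u v p 1 (nat \<lceil>t * real p\<rceil>)) / (real p)\<^sup>2) \<longlongrightarrow>
      real u * real v * trapezoid (min (min \<alpha>' \<beta>') (1 - \<gamma>')) (max 0 (\<alpha>' + \<beta>' - \<gamma>'))) at_top_primes"
    "((\<lambda>p. real (colength a b c u v p 1 (nat \<lfloor>t * real p\<rfloor>)) / (real p)\<^sup>2) \<longlongrightarrow>
      real u * real v * trapezoid (min (min \<alpha>' \<beta>') (1 - \<gamma>')) (max 0 (\<alpha>' + \<beta>' - \<gamma>'))) at_top_primes"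
    unfolding \<alpha>'_def \<beta>'_def \<gamma>'_def by (intro colength_one_limit uv t; simp)+
qed

text \<open>For k = 0 the bound is infinite and the conclusion reads 0 < 1.\<close>

lemma less_inverse_ereal_iff:
  assumes "0 \<le> t" "ereal t < 1 / ereal (real k)"
  shows "real k * t < 1"
proof (cases "k = 0")
  case False
  then have "1 / ereal (real k) = ereal (1 / real k)"
    by (simp add: one_ereal_def)
  then have "t < 1 / real k" using assms by simp
  then show ?thesis using False by (simp add: field_simps)
qed simp

section \<open>The four cases\<close>

lemma trapezoid_wide: "2 * K \<le> S \<Longrightarrow> trapezoid K S = K * (S - K)"
  by (simp add: trapezoid_def max_def power2_eq_square field_simps)

lemma trapezoid_narrow: "S \<le> 2 * K \<Longrightarrow> trapezoid K S = S\<^sup>2 / 4"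
  by (simp add: trapezoid_def max_def)

theorem theoremA:
  fixes a b c u v :: nat and t :: real
  assumes "u > 0" and "v > 0" and "c > 0"
    and "0 \<le> t" and "ereal t < lambda a b c u v"
  defines "s \<equiv> \<lambda>p. F_signature p (reduce_mod p (poly_g a b c u v)) t"
    and "case1 \<equiv> t * a * v + u \<ge> t * b * u + v + c * u * v * t"
    and "case2 \<equiv> t * b * u + v \<ge> t * a * v + u + c * u * v * t"
    and "case3 \<equiv> t * c * u * v + u + v \<ge> t * a * v + t * b * u + 2 * u * v"
  shows "(case1 \<longrightarrow> (s \<longlongrightarrow> (1 - a * t) * (1 - (b + c * v) * t)) at_top_primes) \<and>
    (case2 \<longrightarrow> (s \<longlongrightarrow> (1 - b * t) * (1 - (a + c * u) * t)) at_top_primes) \<and>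
    (case3 \<longrightarrow> (s \<longlongrightarrow> (1 - c * t) * (v * (1 - a * t) + u * (1 - b * t) - u * v)) at_top_primes) \<and>
    (\<not> case1 \<and> \<not> case2 \<and> \<not> case3 \<longrightarrow>
      (s \<longlongrightarrow> 1 / (4 * real u * real v) * (u + v - t * (a * v + b * u + c * u * v))\<^sup>2) at_top_primes)"
proof -
  have t: "real a * t < 1" "real b * t < 1" "real c * t < 1" "t < lambda0 a b c u v"
    using assms(4,5) by (auto simp: lambda_def intro!: less_inverse_ereal_iff)
  define \<alpha> \<beta> \<gamma> where "\<alpha> = (1 - real a * t) / real u" and "\<beta> = (1 - real b * t) / real v" and "\<gamma> = real c * t"
  define \<Phi> where "\<Phi> = real u * real v * trapezoid (min (min \<alpha> \<beta>) (1 - \<gamma>)) (\<alpha> + \<beta> - \<gamma>)"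
  have uv: "real u > 0" "real v > 0" "real u \<ge> 1" "real v \<ge> 1"
    using assms(1,2) by simp_all
  have \<alpha>: "real u * \<alpha> = 1 - real a * t" "\<alpha> > 0" "\<alpha> \<le> 1"
    and \<beta>: "real v * \<beta> = 1 - real b * t" "\<beta> > 0" "\<beta> \<le> 1"
    and \<gamma>: "\<gamma> \<ge> 0" "\<gamma> < 1"
  proof -
    show "real u * \<alpha> = 1 - real a * t" "real v * \<beta> = 1 - real b * t" "\<alpha> > 0" "\<beta> > 0"
      using uv t by (simp_all add: \<alpha>_def \<beta>_def)
    have "1 - real a * t \<le> real u" "1 - real b * t \<le> real v"
      using uv(3,4) assms(4) by (smt (verit) mult_nonneg_nonneg of_nat_0_le_iff)+
    then show "\<alpha> \<le> 1" "\<beta> \<le> 1"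
      using uv by (simp_all add: \<alpha>_def \<beta>_def)
    show "\<gamma> \<ge> 0" "\<gamma> < 1" using assms(4) t by (simp_all add: \<gamma>_def)
  qed
  \<comment> \<open>This is t < \<open>lambda0\<close> with the denominator cleared; it removes the
    maximum with 0 from the general limit.\<close>
  have pos: "\<alpha> + \<beta> - \<gamma> > 0"
  proof -
    have "real a / real u + real b / real v + real c > 0"
      using assms(3) by (simp add: add_nonneg_pos)
    then have "t * (real a / real u + real b / real v + real c) < 1 / real u + 1 / real v"
      using t(4) by (simp add: lambda0_def pos_less_divide_eq)
    then show ?thesis
      by (simp add: \<alpha>_def \<beta>_def \<gamma>_def diff_divide_distrib algebra_simps)
  qed
  have lim: "(s \<longlongrightarrow> \<Phi>) at_top_primes"
    using F_signature_limit[OF assms(1,2,4) t(1-3)] pos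
    unfolding s_def \<Phi>_def \<alpha>_def \<beta>_def \<gamma>_def by (simp add: max_def)
  have uv\<alpha>: "real u * real v * \<alpha> = v * (1 - a * t)" and uv\<beta>: "real u * real v * \<beta> = u * (1 - b * t)"
    and uv\<gamma>: "real u * real v * \<gamma> = c * u * v * t"
    using \<alpha>(1) \<beta>(1) by (simp_all add: \<gamma>_def mult_ac)
  \<comment> \<open>The conditions of the theorem are comparisons between \<alpha>, \<beta>,
    \<gamma> multiplied by uv.\<close>
  have uvle: "real u * real v * x \<le> real u * real v * y \<longleftrightarrow> x \<le> y" for x y
    using uv by simp
  have c1: "case1 \<longleftrightarrow> \<alpha> + \<gamma> \<le> \<beta>"
    unfolding case1_def uvle[of "\<alpha> + \<gamma>" \<beta>, symmetric] distrib_left uv\<alpha> uv\<beta> uv\<gamma> by (simp add: algebra_simps)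
  have c2: "case2 \<longleftrightarrow> \<beta> + \<gamma> \<le> \<alpha>"
    unfolding case2_def uvle[of "\<beta> + \<gamma>" \<alpha>, symmetric] distrib_left uv\<alpha> uv\<beta> uv\<gamma> by (simp add: algebra_simps)
  have c3: "case3 \<longleftrightarrow> 2 \<le> \<alpha> + \<beta> + \<gamma>"
    unfolding case3_def uvle[of 2 "\<alpha> + \<beta> + \<gamma>", symmetric] distrib_left uv\<alpha> uv\<beta> uv\<gamma> by (simp add: algebra_simps)
  have "\<Phi> = (1 - a * t) * (1 - (b + c * v) * t)" if case1
  proof -
    \<comment> \<open>From \<alpha> + \<gamma> \<le> \<beta> follow \<alpha> \<le> \<beta>, as
      \<gamma> \<ge> 0, and \<alpha> \<le> 1 - \<gamma>, as \<beta> \<le> 1.\<close>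
    have "min (min \<alpha> \<beta>) (1 - \<gamma>) = \<alpha>" "2 * \<alpha> \<le> \<alpha> + \<beta> - \<gamma>"
      using that \<alpha> \<beta> \<gamma> unfolding c1 by (simp_all add: min_def)
    then have "\<Phi> = (real u * \<alpha>) * (real v * (\<beta> - \<gamma>))"
      by (simp add: \<Phi>_def trapezoid_wide mult_ac)
    also have "real v * (\<beta> - \<gamma>) = 1 - (b + c * v) * t"
      using \<beta>(1) by (simp add: \<gamma>_def algebra_simps)
    finally show ?thesis
      by (simp add: \<alpha>(1))
  qed
  moreover have "\<Phi> = (1 - b * t) * (1 - (a + c * u) * t)" if case2
  proof -
    have "min (min \<alpha> \<beta>) (1 - \<gamma>) = \<beta>" "2 * \<beta> \<le> \<alpha> + \<beta> - \<gamma>"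
      using that \<alpha> \<beta> \<gamma> unfolding c2 by (simp_all add: min_def)
    then have "\<Phi> = (real v * \<beta>) * (real u * (\<alpha> - \<gamma>))"
      by (simp add: \<Phi>_def trapezoid_wide mult_ac)
    also have "real u * (\<alpha> - \<gamma>) = 1 - (a + c * u) * t"
      using \<alpha>(1) by (simp add: \<gamma>_def algebra_simps)
    finally show ?thesis
      by (simp add: \<beta>(1))
  qed
  moreover have "\<Phi> = (1 - c * t) * (v * (1 - a * t) + u * (1 - b * t) - u * v)" if case3
  proof -
    \<comment> \<open>Here \<alpha> \<ge> 2 - \<beta> - \<gamma> \<ge> 1 - \<gamma> because \<beta>
      \<le> 1, and likewise for \<beta>.\<close>
    have eq: "min (min \<alpha> \<beta>) (1 - \<gamma>) = 1 - \<gamma>" "2 * (1 - \<gamma>) \<le> \<alpha> + \<beta> - \<gamma>"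
      using that \<alpha> \<beta> \<gamma> unfolding c3 by (simp_all add: min_def)
    have "\<Phi> = real u * real v * ((1 - \<gamma>) * (\<alpha> + \<beta> - \<gamma> - (1 - \<gamma>)))"
      unfolding \<Phi>_def eq(1) by (simp only: trapezoid_wide[OF eq(2)])
    then have "\<Phi> = (1 - \<gamma>) * (real u * real v * \<alpha> + real u * real v * \<beta> - real u * real v)"
      by (simp add: algebra_simps)
    then show ?thesis
      unfolding uv\<alpha> uv\<beta> by (simp add: \<gamma>_def)
  qed
  moreover have "\<Phi> = 1 / (4 * real u * real v) * (u + v - t * (a * v + b * u + c * u * v))\<^sup>2"
    if "\<not> case1 \<and> \<not> case2 \<and> \<not> case3"
  proof -
    \<comment> \<open>The three negated cases say that the base is less than 2 \<alpha>, 2 \<beta>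
      and 2 (1 - \<gamma>), respectively.\<close>
    have "\<alpha> + \<beta> - \<gamma> \<le> 2 * min (min \<alpha> \<beta>) (1 - \<gamma>)"
      using that unfolding c1 c2 c3 by (simp add: min_def)
    then have "\<Phi> = 1 / (4 * real u * real v) * (real u * real v * (\<alpha> + \<beta> - \<gamma>))\<^sup>2"
      using uv by (simp add: \<Phi>_def trapezoid_narrow power_mult_distrib power2_eq_square field_simps)
    also have "real u * real v * (\<alpha> + \<beta> - \<gamma>) = u + v - t * (a * v + b * u + c * u * v)"
      unfolding right_diff_distrib distrib_left uv\<alpha> uv\<beta> uv\<gamma> by (simp add: algebra_simps)
    finally show ?thesis .
  qed
  \<comment> \<open>All formulas evaluate the same limit \<Phi>, so overlapping cases agree.\<close>
  ultimately show ?thesis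
    using lim by metis
qed

end
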